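(* Let $\{f_1,\dots,f_N\}$ be a conformal iterated function system in $\mathbb{R}^n$ with invariant set $E$, and let $\{g_1,\dots,g_P\}$ be a conformal iterated function system in $\mathbb{R}^p$ with invariant set $F$. Suppose that both systems satisfy the open set condition and that $E$ and $F$ have the same Hausdorff dimension $s$. If there are an $\mathcal{H}^s$ measurable subset $E'$ of $E$ with $\mathcal{H}^s(E')>0$ and a bilipschitz map $h:E'\to F$ (not necessarily onto), then there exists a bilipschitz map $\tilde h:E\to F$ (not necessarily onto).
   Context: $\mathcal{H}^s$ denotes $s$-dimensional Hausdorff measure. A map $h:A\to B$, $A\subset\mathbb{R}^n$, $B\subset\mathbb{R}^p$, is bilipschitz if there is $L<\infty$ such that $|x-y|/L\le |h(x)-h(y)|\le L|x-y|$ for all $x,y\in A$; $h$ is not required to be onto $B$. A conformal iterated function system in $\mathbb{R}^n$ is a finite family $\{f_1,\dots,f_N\}$, $N\ge 2$, for which there is an open connected set $V\subset\mathbb{R}^n$ such that each $f_i:V\to V$ is an injective conformal map (its derivative at every point is a nonzero multiple of an orthogonal map) of class $C^{1+\gamma}$ for some fixed $\gamma>0$ (the partial derivatives are Hölder continuous with exponent $\gamma$), there is a constant $L_0<1$ with $|f_i(x)-f_i(y)|\le L_0|x-y|$ for all $x,y\in V$ and $i=1,\dots,N$, and there are constants $0<c_1<C_1<1$ such that $c_1\le \|Df_i(x)\|\le C_1$ for all $x\in V$, $i=1,\dots,N$, where $\|\cdot\|$ is the operator norm. Its invariant set is the unique nonempty compact set $E\subset V$ with $E=\bigcup_{i=1}^N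 f_i(E)$. The system satisfies the open set condition if there is a nonempty bounded open set $O\subset V$ whose closure is contained in $V$ and such that the sets $f_i(O)$, $i=1,\dots,N$, are pairwise disjoint subsets of $O$. The system $\{g_1,\dots,g_P\}$ in $\mathbb{R}^p$ is understood in the same sense, with its own domain and constants. *)

theory Defs
  imports "HOL-Analysis.Analysis"
begin

section \<open>Hausdorff measure and dimension\<close>

text \<open>
  The gauge is \<open>diam(S)^s\<close> with the usual conventions that the empty set contributes \<open>0\<close> and a
  nonempty set contributes \<open>1\<close> when \<open>s = 0\<close>. The case distinction is needed because
  \<open>0 powr 0 = 0\<close>.
\<close>

definition hausdorff_gauge :: "real \<Rightarrow> 'a::metric_space set \<Rightarrow> ennreal" where
  "hausdorff_gauge s S =
     (if S = {} then 0 else if s = 0 then 1 else ennreal (diameter S powr s))"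

text \<open>
  The covering sets are required to be bounded because \<^const>\<open>diameter\<close> has no meaningful value on
  unbounded sets. Finite covers are included, since the sets may be empty.
\<close>

definition hausdorff_content :: "real \<Rightarrow> real \<Rightarrow> 'a::metric_space set \<Rightarrow> ennreal" where
  "hausdorff_content s \<delta> A =
     (INF U \<in> {U :: nat \<Rightarrow> 'a set. A \<subseteq> (\<Union>i. U i) \<and> (\<forall>i. bounded (U i) \<and> diameter (U i) \<le> \<delta>)}.
        \<Sum>i. hausdorff_gauge s (U i))"

text \<open>
  This is an outer measure defined on all sets; its measurable sets (in the sense of Caratheodory)
  are \<open>lambda_system UNIV UNIV (hausdorff_measure s)\<close>.
\<close>

definition hausdorff_measure :: "real \<Rightarrow> 'a::metric_space set \<Rightarrow> ennreal" where
  "hausdorff_measure s A = (SUP \<delta> \<in> {0<..}. hausdorff_content s \<delta> A)"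

definition hausdorff_dim :: "'a::metric_space set \<Rightarrow> ereal" where
  "hausdorff_dim A = (INF s \<in> {s. 0 \<le> s \<and> hausdorff_measure s A = 0}. ereal s)"


section \<open>Bilipschitz maps\<close>

text \<open>
  Only the values of \<open>h\<close> on \<open>A\<close> matter. The condition \<open>0 < L\<close> excludes \<open>L = 0\<close>, for which division
  by zero would admit constant maps.
\<close>

definition bilipschitz_map ::
    "('a::metric_space \<Rightarrow> 'b::metric_space) \<Rightarrow> 'a set \<Rightarrow> 'b set \<Rightarrow> bool" where
  "bilipschitz_map h A B \<longleftrightarrow>
     h ` A \<subseteq> B \<and>
     (\<exists>L>0. \<forall>x\<in>A. \<forall>y\<in>A. dist x y / L \<le> dist (h x) (h y) \<and> dist (h x) (h y) \<le> L * dist x y)"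


section \<open>Conformal iterated function systems\<close>

definition conformal_on :: "(real^'n) set \<Rightarrow> (real^'n \<Rightarrow> real^'n) \<Rightarrow> bool" where
  "conformal_on V f \<longleftrightarrow>
     (\<forall>x\<in>V. \<exists>c T. c \<noteq> 0 \<and> orthogonal_transformation T \<and>
        (f has_derivative (\<lambda>v. c *\<^sub>R T v)) (at x))"

definition holder_on :: "real \<Rightarrow> 'a::metric_space set \<Rightarrow> ('a \<Rightarrow> real) \<Rightarrow> bool" where
  "holder_on \<gamma> V g \<longleftrightarrow> (\<exists>C. \<forall>x\<in>V. \<forall>y\<in>V. \<bar>g x - g y\<bar> \<le> C * dist x y powr \<gamma>)"

definition partial_deriv :: "(real^'n \<Rightarrow> real^'m) \<Rightarrow> 'n \<Rightarrow> 'm \<Rightarrow> real^'n \<Rightarrow> real" where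
  "partial_deriv f j k x = frechet_derivative f (at x) (axis j 1) $ k"

definition C1_holder_on :: "real \<Rightarrow> (real^'n) set \<Rightarrow> (real^'n \<Rightarrow> real^'m) \<Rightarrow> bool" where
  "C1_holder_on \<gamma> V f \<longleftrightarrow>
     (\<forall>x\<in>V. f differentiable (at x)) \<and> (\<forall>j k. holder_on \<gamma> V (partial_deriv f j k))"

text \<open>
  The system consists of the maps \<open>f i\<close> for \<open>i \<in> {1..N}\<close>, restricted to their common domain \<open>V\<close>.
\<close>

definition conformal_ifs :: "(real^'n) set \<Rightarrow> nat \<Rightarrow> (nat \<Rightarrow> real^'n \<Rightarrow> real^'n) \<Rightarrow> bool" where
  "conformal_ifs V N f \<longleftrightarrow>
     2 \<le> N \<and> open V \<and> connected V \<and>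
     (\<forall>i\<in>{1..N}. f i ` V \<subseteq> V \<and> inj_on (f i) V \<and> conformal_on V (f i)) \<and>
     (\<exists>\<gamma>>0. \<forall>i\<in>{1..N}. C1_holder_on \<gamma> V (f i)) \<and>
     (\<exists>L\<^sub>0<1. \<forall>i\<in>{1..N}. L\<^sub>0-lipschitz_on V (f i)) \<and>
     (\<exists>c\<^sub>1 C\<^sub>1. 0 < c\<^sub>1 \<and> c\<^sub>1 < C\<^sub>1 \<and> C\<^sub>1 < 1 \<and>
        (\<forall>i\<in>{1..N}. \<forall>x\<in>V.
           c\<^sub>1 \<le> onorm (frechet_derivative (f i) (at x)) \<and>
           onorm (frechet_derivative (f i) (at x)) \<le> C\<^sub>1))"

text \<open>
  For a conformal iterated function system on \<open>V\<close> at most one set \<open>E\<close> has this property, by the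
  contraction condition.
\<close>

definition ifs_invariant_set ::
    "(real^'n) set \<Rightarrow> nat \<Rightarrow> (nat \<Rightarrow> real^'n \<Rightarrow> real^'n) \<Rightarrow> (real^'n) set \<Rightarrow> bool" where
  "ifs_invariant_set V N f E \<longleftrightarrow>
     E \<noteq> {} \<and> compact E \<and> E \<subseteq> V \<and> E = (\<Union>i\<in>{1..N}. f i ` E)"

definition open_set_condition ::
    "(real^'n) set \<Rightarrow> nat \<Rightarrow> (nat \<Rightarrow> real^'n \<Rightarrow> real^'n) \<Rightarrow> bool" where
  "open_set_condition V N f \<longleftrightarrow>
     (\<exists>U. U \<noteq> {} \<and> bounded U \<and> open U \<and> closure U \<subseteq> V \<and>
        (\<forall>i\<in>{1..N}. f i ` U \<subseteq> U) \<and> disjoint_family_on (\<lambda>i. f i ` U) {1..N})"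

end

theory Submission
  imports Defs
begin

text \<open>
  Write \<open>f\<^sub>w\<close> for the composition of the \<open>f i\<close> along a word \<open>w\<close>, and \<open>E\<^sub>w = f\<^sub>w(E)\<close>. By bounded distortion
  \<open>f\<^sub>w\<close> is bilipschitz on \<open>E\<close> with ratio \<open>r w\<close>, up to constants independent of \<open>w\<close>. The open set condition
  and the value of the dimension make the sums of \<open>r(w)\<^sup>s\<close> over the words of a given length bounded,
  so a subset of \<open>E\<close> that misses a subcylinder of bounded relative order in each \<open>E\<^sub>w\<close> is
  \<open>s\<close>-null. Hence, for every \<open>k\<close>, some \<open>E\<^sub>w\<close> has all its subcylinders of relative order \<open>k\<close> met by \<open>E'\<close>. By
  the open set condition for \<open>g\<close>, boundedly many cylinders \<open>F\<^sub>v\<close> with \<open>r v\<close> comparable to \<open>r w\<close> cover the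
  image of \<open>E' \<inter> E\<^sub>w\<close> under \<open>h\<close>; after passing to a subcylinder a single \<open>F\<^sub>v\<close> suffices for a dense set of points.
  The maps \<open>g\<^sub>v\<inverse> \<circ> h \<circ> f\<^sub>w\<close> are then uniformly bilipschitz on increasingly dense subsets of \<open>E\<close>, and by
  Tychonoff's theorem they have a limit.
\<close>

section \<open>Hausdorff content\<close>

text \<open>The maps enter the argument only through the locale \<open>quasi_self_similar\<close>:
  quasi-multiplicative ratios, uniform bilipschitz bounds, and a count of prefix-incomparable words
  near a ball. No measure on the space of words is built: finite sums of \<open>r v powr s\<close>
  over the extensions \<open>v\<close> of a word \<open>w\<close> stand in for the mass of its
  cylinder. These sums are exactly additive, whereas comparing them with \<open>r w powr s\<close>
  costs a constant factor; the decay argument iterates additivity so that this factor does not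
  accumulate. The image of one cylinder of \<open>E\<close> may spread over several cylinders of
  \<open>F\<close>, which may touch or overlap. Gluing the inverses of different
  \<open>word_map g v\<close> could bring images of distant points together, so a single
  \<open>v\<close> has to be isolated before a limit is taken. The approximating maps obey distance
  bounds only up to an additive error and need not be continuous, which is why the limit is found by
  compactness of a product and not by equicontinuity.\<close>

lemma hausdorff_gauge_le:
  assumes "0 \<le> s" "0 < d" "diameter S \<le> d" "bounded S"
  shows "hausdorff_gauge s S \<le> ennreal (d powr s)"
proof -
  have "0 \<le> diameter S" using assms(4) by (rule diameter_ge_0)
  then show ?thesis using assms
    by (auto simp: hausdorff_gauge_def intro!: ennreal_leI powr_mono2)
qed

lemma hausdorff_content_le_finite_cover:
  assumes "finite G" "A \<subseteq> (\<Union>w\<in>G. B w)" "0 \<le> \<delta>"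
    and "\<And>w. w \<in> G \<Longrightarrow> bounded (B w) \<and> diameter (B w) \<le> \<delta>"
  shows "hausdorff_content s \<delta> A \<le> (\<Sum>w\<in>G. hausdorff_gauge s (B w))"
proof -
  obtain e where e: "bij_betw e {..<card G} G"
    using ex_bij_betw_nat_finite[OF assms(1)] by (auto simp: atLeast0LessThan)
  define U where "U i = (if i < card G then B (e i) else {})" for i
  have eG: "e i \<in> G" if "i < card G" for i
    using e that by (auto simp: bij_betw_def)
  have "A \<subseteq> (\<Union>i. U i)"
  proof
    fix x assume "x \<in> A"
    then obtain w where w: "w \<in> G" "x \<in> B w" using assms(2) by blast
    from w(1) have "w \<in> e ` {..<card G}" using e by (simp add: bij_betw_def)
    then obtain i where "i < card G" "e i = w" by auto
    then have "x \<in> U i" using w by (simp add: U_def)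
    then show "x \<in> (\<Union>i. U i)" by blast
  qed
  moreover have "bounded (U i) \<and> diameter (U i) \<le> \<delta>" for i
    using assms(3,4) eG by (auto simp: U_def)
  ultimately have "hausdorff_content s \<delta> A \<le> (\<Sum>i. hausdorff_gauge s (U i))"
    unfolding hausdorff_content_def by (intro INF_lower) auto
  also have "\<dots> = (\<Sum>i<card G. hausdorff_gauge s (U i))"
    by (intro suminf_finite) (auto simp: U_def hausdorff_gauge_def)
  also have "\<dots> = (\<Sum>i<card G. hausdorff_gauge s (B (e i)))"
    by (intro sum.cong) (auto simp: U_def)
  also have "\<dots> = (\<Sum>w\<in>G. hausdorff_gauge s (B w))"
    using e by (rule sum.reindex_bij_betw)
  finally show ?thesis .
qed

lemma hausdorff_content_antimono:
  "\<delta> \<le> \<delta>' \<Longrightarrow> hausdorff_content s \<delta>' A \<le> hausdorff_content s \<delta> A"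
  unfolding hausdorff_content_def by (intro INF_superset_mono) (auto intro: order_trans)

lemma hausdorff_measure_mono: "A \<subseteq> B \<Longrightarrow> hausdorff_measure s A \<le> hausdorff_measure s B"
  unfolding hausdorff_measure_def hausdorff_content_def
  by (intro SUP_mono bexI INF_superset_mono) auto

lemma hausdorff_content_le_measure:
  "0 < \<delta> \<Longrightarrow> hausdorff_content s \<delta> A \<le> hausdorff_measure s A"
  unfolding hausdorff_measure_def by (intro SUP_upper) auto

lemma hausdorff_measure_eq_0_mono:
  assumes "0 \<le> s" "s < t" "hausdorff_measure s A = 0"
  shows "hausdorff_measure t A = 0"
proof -
  have "hausdorff_content t \<delta> A = 0" if "0 < \<delta>" for \<delta>
  proof -
    \<comment> \<open>For diameters at most 1 the power with exponent \<open>t\<close> is at most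
      the one with exponent \<open>s\<close>, and at most 1, which is the gauge of a nonempty set
      when \<open>s = 0\<close>.\<close>
    let ?d = "min \<delta> 1"
    have gauge: "hausdorff_gauge t U \<le> hausdorff_gauge s U"
      if "bounded U" "diameter U \<le> ?d" for U :: "'a set"
    proof -
      have "0 \<le> diameter U" using that(1) by (rule diameter_ge_0)
      then have "diameter U powr t \<le> diameter U powr s" "diameter U powr t \<le> 1"
        using that assms by (auto intro!: powr_mono' powr_le1)
      then show ?thesis using assms by (auto simp: hausdorff_gauge_def intro!: ennreal_leI)
    qed
    have "hausdorff_content t \<delta> A \<le> hausdorff_content t ?d A"
      by (intro hausdorff_content_antimono) auto
    also have "\<dots> \<le> hausdorff_content s ?d A"
      unfolding hausdorff_content_def by (intro INF_mono bexI suminf_le) (use gauge in auto)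
    also have "\<dots> \<le> hausdorff_measure s A"
      using that by (intro hausdorff_content_le_measure) auto
    finally show ?thesis using assms(3) by simp
  qed
  then show ?thesis by (simp add: hausdorff_measure_def)
qed

lemma hausdorff_dim_nonneg: "hausdorff_dim A = ereal s \<Longrightarrow> 0 \<le> s"
proof -
  assume "hausdorff_dim A = ereal s"
  moreover have "0 \<le> hausdorff_dim A"
    unfolding hausdorff_dim_def by (intro INF_greatest) auto
  ultimately show ?thesis by simp
qed

lemma hausdorff_measure_above_dim:
  assumes "hausdorff_dim A = ereal s" "s < t"
  shows "hausdorff_measure t A = 0"
proof -
  have "(INF s \<in> {s. 0 \<le> s \<and> hausdorff_measure s A = 0}. ereal s) < ereal t"
    using assms by (simp add: hausdorff_dim_def)
  then obtain u where "0 \<le> u" "hausdorff_measure u A = 0" "u < t"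
    by (auto simp: INF_less_iff)
  then show ?thesis using hausdorff_measure_eq_0_mono by blast
qed


section \<open>Words and cylinders\<close>

primrec word_map :: "('i \<Rightarrow> 'a \<Rightarrow> 'a) \<Rightarrow> 'i list \<Rightarrow> 'a \<Rightarrow> 'a" where
  "word_map f [] = id"
| "word_map f (i # w) = f i \<circ> word_map f w"

lemma word_map_append: "word_map f (u @ v) x = word_map f u (word_map f v x)"
  by (induction u) auto

definition words :: "'i set \<Rightarrow> nat \<Rightarrow> 'i list set" where
  "words I n = {w. set w \<subseteq> I \<and> length w = n}"

lemma words_0 [simp]: "words I 0 = {[]}"
  by (auto simp: words_def)

lemma finite_words: "finite I \<Longrightarrow> finite (words I n)"
  unfolding words_def by (rule finite_lists_length_eq)

lemma bij_betw_words_append: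
  "bij_betw (\<lambda>(u, v). u @ v) (words I m \<times> words I n) (words I (m + n))"
proof (rule bij_betwI[where g = "\<lambda>w. (take m w, drop m w)"])
  show "(\<lambda>w. (take m w, drop m w)) \<in> words I (m + n) \<rightarrow> words I m \<times> words I n"
    by (auto simp: words_def dest: in_set_takeD in_set_dropD)
qed (auto simp: words_def)

lemma sum_words_append:
  "(\<Sum>w\<in>words I (m + n). \<phi> w) = (\<Sum>u\<in>words I m. \<Sum>v\<in>words I n. \<phi> (u @ v))"
  using sum.reindex_bij_betw[OF bij_betw_words_append, of \<phi> I m n]
  by (simp add: sum.cartesian_product split_def)

text \<open>The number \<open>r w\<close> models the size of the derivative of
  \<open>word_map f w\<close>. In \<open>count\<close> the variable \<open>R\<close> is universally
  quantified, so \<open>M\<close> may depend on \<open>R\<close> but not on scale or centre; the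
  last premise forbids that a word of \<open>S\<close> properly extends another. Finiteness of
  \<open>S\<close> is a premise because \<open>card\<close> is uninformative on infinite sets;
  \<open>stopping_count\<close> recovers it.\<close>

locale quasi_self_similar =
  fixes I :: "'i set" and f :: "'i \<Rightarrow> 'a::metric_space \<Rightarrow> 'a" and E :: "'a set"
    and r :: "'i list \<Rightarrow> real" and K C q :: real
  assumes finite_I: "finite I"
    and compact_E: "compact E" and E_nonempty: "E \<noteq> {}"
    and invariant: "E = (\<Union>i\<in>I. f i ` E)"
    and K_ge_1: "1 \<le> K" and C_ge_1: "1 \<le> C" and q_pos: "0 < q" and q_less_1: "q < 1"
    and r_Nil: "r [] = 1"
    and r_pos: "set w \<subseteq> I \<Longrightarrow> 0 < r w"
    and r_le: "set w \<subseteq> I \<Longrightarrow> r w \<le> q ^ length w"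
    and r_append: "set (w @ v) \<subseteq> I \<Longrightarrow> r w * r v / K \<le> r (w @ v) \<and> r (w @ v) \<le> K * (r w * r v)"
    and bilip: "set w \<subseteq> I \<Longrightarrow> x \<in> E \<Longrightarrow> y \<in> E \<Longrightarrow>
      r w * dist x y / C \<le> dist (word_map f w x) (word_map f w y) \<and>
      dist (word_map f w x) (word_map f w y) \<le> C * (r w * dist x y)"
    and count: "\<exists>M::nat. \<forall>\<rho> z S. 0 < \<rho> \<longrightarrow> finite S \<longrightarrow>
      (\<forall>w\<in>S. set w \<subseteq> I \<and> \<rho> \<le> R * r w \<and> r w \<le> \<rho> \<and> word_map f w ` E \<inter> cball z (R * \<rho>) \<noteq> {}) \<longrightarrow>
      (\<forall>u\<in>S. \<forall>v. u @ v \<in> S \<longrightarrow> v = []) \<longrightarrow> card S \<le> M"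
begin

abbreviation cyl :: "'i list \<Rightarrow> 'a set" where
  "cyl w \<equiv> word_map f w ` E"

lemma I_nonempty: "I \<noteq> {}"
  using E_nonempty invariant by auto

lemma words_nonempty: "words I n \<noteq> {}"
proof -
  obtain i where "i \<in> I" using I_nonempty by auto
  then have "replicate n i \<in> words I n" by (auto simp: words_def)
  then show ?thesis by auto
qed

lemma word_map_in_E: "set w \<subseteq> I \<Longrightarrow> x \<in> E \<Longrightarrow> word_map f w x \<in> E"
  by (induction w) (use invariant in auto)

lemma cyl_cover: "E = (\<Union>w\<in>words I n. cyl w)"
proof
  show "E \<subseteq> (\<Union>w\<in>words I n. cyl w)"
  proof (induction n)
    case (Suc n)
    show ?case
    proof
      fix x assume "x \<in> E"
      then obtain i y where y: "i \<in> I" "y \<in> E" "x = f i y" using invariant by blast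
      then obtain w z where "w \<in> words I n" "z \<in> E" "y = word_map f w z" using Suc by blast
      then have "i # w \<in> words I (Suc n)" "x = word_map f (i # w) z" "z \<in> E"
        using y by (auto simp: words_def)
      then show "x \<in> (\<Union>w\<in>words I (Suc n). cyl w)" by blast
    qed
  qed auto
qed (auto simp: words_def word_map_in_E)

lemma r_le_1: "set w \<subseteq> I \<Longrightarrow> r w \<le> 1"
  using r_le[of w] q_pos q_less_1 power_le_one[of q "length w"] by linarith

lemma r_min:
  obtains c where "0 < c" "c \<le> 1" "\<And>u. u \<in> words I n \<Longrightarrow> c \<le> r u"
proof -
  let ?c = "Min (r ` words I n)"
  have fin: "finite (r ` words I n)" "r ` words I n \<noteq> {}"
    using words_nonempty finite_words[OF finite_I] by auto
  have "?c \<in> r ` words I n" using fin by (rule Min_in)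
  then have "0 < ?c" "?c \<le> 1" using r_pos r_le_1 by (auto simp: words_def)
  moreover have "?c \<le> r u" if "u \<in> words I n" for u using fin that by auto
  ultimately show ?thesis using that by blast
qed

lemma bounded_E: "bounded E"
  using compact_E by (rule compact_imp_bounded)

lemma dist_E_le: "x \<in> E \<Longrightarrow> y \<in> E \<Longrightarrow> dist x y \<le> diameter E"
  using bounded_E by (rule diameter_bounded_bound)

lemma diameter_E_nonneg: "0 \<le> diameter E"
  using bounded_E by (rule diameter_ge_0)

text \<open>The summand 1 makes \<open>D \<ge> 1\<close>, even if \<open>E\<close> is a single
  point.\<close>

definition D :: real where "D = C * (diameter E + 1)"

lemma D_ge_1: "1 \<le> D"
proof -
  have "1 * 1 \<le> C * (diameter E + 1)"
    using C_ge_1 diameter_E_nonneg by (intro mult_mono) auto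
  then show ?thesis by (simp add: D_def)
qed

lemma cyl_dist_le:
  assumes "set w \<subseteq> I" "x \<in> cyl w" "y \<in> cyl w"
  shows "dist x y \<le> D * r w"
proof -
  obtain x' y' where x': "x' \<in> E" "y' \<in> E" "x = word_map f w x'" "y = word_map f w y'"
    using assms by blast
  then have "dist x y \<le> C * (r w * dist x' y')" using bilip assms(1) by blast
  also have "\<dots> \<le> C * (r w * (diameter E + 1))"
    using dist_E_le[OF x'(1,2)] r_pos[OF assms(1)] C_ge_1 by (intro mult_left_mono) auto
  finally show ?thesis by (simp add: D_def mult_ac)
qed

lemma bounded_cyl: "set w \<subseteq> I \<Longrightarrow> bounded (cyl w)"
  using bounded_E by (rule bounded_subset) (auto intro: word_map_in_E)

lemma diameter_cyl_le: "set w \<subseteq> I \<Longrightarrow> diameter (cyl w) \<le> D * r w"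
  using E_nonempty cyl_dist_le[of w] by (auto simp: diameter_def intro!: cSUP_least)


section \<open>Sums over words\<close>

definition Y :: "real \<Rightarrow> nat \<Rightarrow> real" where
  "Y t n = (\<Sum>w\<in>words I n. r w powr t)"

text \<open>A finite-level substitute for the mass of the cylinder of \<open>w\<close>: exactly
  additive over the extensions of \<open>w\<close> (\<open>Z_add\<close>), and within a factor
  \<open>K powr t\<close> of \<open>r w powr t * Y t n\<close> (\<open>Z_bounds\<close>).\<close>

definition Z :: "real \<Rightarrow> 'i list \<Rightarrow> nat \<Rightarrow> real" where
  "Z t w n = (\<Sum>v\<in>words I n. r (w @ v) powr t)"

lemma Z_Nil: "Z t [] n = Y t n"
  by (simp add: Z_def Y_def)

lemma Z_0: "Z t w 0 = r w powr t"
  by (simp add: Z_def)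

lemma Y_pos: "0 < Y t n"
  unfolding Y_def using words_nonempty finite_words[OF finite_I]
  by (intro sum_pos) (auto simp: words_def dest: r_pos)

lemma Y_0: "Y t 0 = 1"
  by (simp add: Y_def r_Nil)

lemma Y_add: "Y t (m + n) = (\<Sum>w\<in>words I m. Z t w n)"
  by (simp add: Y_def Z_def sum_words_append)

lemma Z_add: "Z t w (m + n) = (\<Sum>u\<in>words I m. Z t (w @ u) n)"
  by (simp add: Z_def sum_words_append)

lemma Z_nonneg: "0 \<le> Z t w n"
  by (simp add: Z_def sum_nonneg)

lemma Z_bounds:
  assumes "0 \<le> t" "set w \<subseteq> I"
  shows "r w powr t * Y t n \<le> K powr t * Z t w n" "Z t w n \<le> K powr t * (r w powr t * Y t n)"
proof -
  have b: "r w powr t * r v powr t \<le> K powr t * r (w @ v) powr t"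
       "r (w @ v) powr t \<le> K powr t * (r w powr t * r v powr t)" if "v \<in> words I n" for v
  proof -
    have wv: "set (w @ v) \<subseteq> I" "set v \<subseteq> I" using that assms by (auto simp: words_def)
    have "r w * r v \<le> K * r (w @ v)" "r (w @ v) \<le> K * (r w * r v)"
      using r_append[OF wv(1)] K_ge_1 by (auto simp: field_simps)
    moreover have "0 < r w" "0 < r v" "0 < r (w @ v)" using r_pos wv assms by auto
    ultimately have "(r w * r v) powr t \<le> (K * r (w @ v)) powr t"
        "r (w @ v) powr t \<le> (K * (r w * r v)) powr t"
      using assms by (auto intro!: powr_mono2)
    then show "r w powr t * r v powr t \<le> K powr t * r (w @ v) powr t"
       "r (w @ v) powr t \<le> K powr t * (r w powr t * r v powr t)"
      using \<open>0 < r w\<close> \<open>0 < r v\<close> \<open>0 < r (w @ v)\<close> K_ge_1 by (auto simp: powr_mult)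
  qed
  show "r w powr t * Y t n \<le> K powr t * Z t w n"
    unfolding Y_def Z_def sum_distrib_left using b by (intro sum_mono) auto
  show "Z t w n \<le> K powr t * (r w powr t * Y t n)"
    unfolding Y_def Z_def sum_distrib_left using b by (intro sum_mono) auto
qed

lemma Y_add_bounds:
  assumes "0 \<le> t"
  shows "Y t m * Y t n \<le> K powr t * Y t (m + n)" "Y t (m + n) \<le> K powr t * (Y t m * Y t n)"
proof -
  have "Y t m * Y t n = (\<Sum>w\<in>words I m. r w powr t * Y t n)"
    by (simp add: Y_def sum_distrib_right)
  also have "\<dots> \<le> (\<Sum>w\<in>words I m. K powr t * Z t w n)"
    using Z_bounds(1)[OF assms] by (intro sum_mono) (auto simp: words_def)
  also have "\<dots> = K powr t * Y t (m + n)" by (simp add: Y_add sum_distrib_left)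
  finally show "Y t m * Y t n \<le> K powr t * Y t (m + n)" .
  have "Y t (m + n) \<le> (\<Sum>w\<in>words I m. K powr t * (r w powr t * Y t n))"
    unfolding Y_add using Z_bounds(2)[OF assms] by (intro sum_mono) (auto simp: words_def)
  also have "\<dots> = K powr t * (Y t m * Y t n)"
    unfolding Y_def[of t m] by (simp add: sum_distrib_left sum_distrib_right mult_ac)
  finally show "Y t (m + n) \<le> K powr t * (Y t m * Y t n)" .
qed


section \<open>Stopping words\<close>

text \<open>Words are cut where the ratio first drops to \<open>\<rho>\<close>. All proper prefixes
  are tested because \<open>r\<close> is only quasi-multiplicative and need not decrease along
  prefixes.\<close>

definition stopping :: "real \<Rightarrow> 'i list set" where
  "stopping \<rho> = {w. set w \<subseteq> I \<and> r w \<le> \<rho> \<and> (\<forall>n<length w. \<rho> < r (take n w))}"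

lemma stopping_prefix:
  assumes "set w \<subseteq> I" "r w \<le> \<rho>"
  obtains u v where "w = u @ v" "u \<in> stopping \<rho>"
proof -
  define n where "n = (LEAST n. r (take n w) \<le> \<rho>)"
  have ex: "r (take (length w) w) \<le> \<rho>" using assms by simp
  have n: "r (take n w) \<le> \<rho>" unfolding n_def using ex by (rule LeastI)
  have le: "n \<le> length w" unfolding n_def using ex by (rule Least_le)
  have "\<rho> < r (take k w)" if "k < n" for k
    using not_less_Least[of k "\<lambda>n. r (take n w) \<le> \<rho>"] that by (auto simp: n_def)
  then have "take n w \<in> stopping \<rho>"
    using n assms le set_take_subset[of n w] by (auto simp: stopping_def min_def)
  moreover have "w = take n w @ drop n w" by simp
  ultimately show ?thesis using that by blast
qed

lemma stopping_antichain: "u \<in> stopping \<rho> \<Longrightarrow> u @ v \<in> stopping \<rho> \<Longrightarrow> v = []"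
  by (fastforce simp: stopping_def dest: spec[of _ "length u"])

text \<open>Without its last letter a stopping word has ratio above \<open>\<rho>\<close>, and one
  letter costs only a bounded factor. The empty word has no last letter; there
  \<open>\<rho> \<le> 1\<close> and \<open>r [] = 1\<close> give the bound.\<close>

lemma stopping_lower:
  obtains c where "0 < c" "\<And>\<rho> w. \<rho> \<le> 1 \<Longrightarrow> w \<in> stopping \<rho> \<Longrightarrow> c * \<rho> \<le> r w"
proof -
  obtain c where c: "0 < c" "c \<le> 1" "\<And>u. u \<in> words I 1 \<Longrightarrow> c \<le> r u"
    using r_min[of 1] by blast
  have "c / K * \<rho> \<le> r w" if "\<rho> \<le> 1" "w \<in> stopping \<rho>" for \<rho> w
  proof (cases w rule: rev_cases)
    case Nil
    have "c * \<rho> \<le> c * 1" using c that by (intro mult_left_mono) auto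
    then have "c * \<rho> \<le> K" using c K_ge_1 by linarith
    then have "c / K * \<rho> \<le> 1" using K_ge_1 by (simp add: field_simps)
    then show ?thesis using Nil r_Nil by simp
  next
    case (snoc u i)
    have u: "set u \<subseteq> I" "i \<in> I" "\<rho> < r u"
      using that snoc by (auto simp: stopping_def dest: spec[of _ "length u"])
    have "c \<le> r [i]" using c(3)[of "[i]"] u by (auto simp: words_def)
    then have "\<rho> * c \<le> r u * r [i]" using u c r_pos[of u]
      by (intro mult_mono) auto
    then have "\<rho> * c / K \<le> r u * r [i] / K" using K_ge_1 by (intro divide_right_mono) auto
    also have "\<dots> \<le> r w" using r_append[of u "[i]"] u snoc by auto
    finally show ?thesis by (simp add: mult_ac)
  qed
  moreover have "0 < c / K" using c K_ge_1 by simp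
  ultimately show ?thesis using that by blast
qed

lemma r_less:
  assumes "0 < \<rho>"
  shows "\<exists>n. \<forall>w\<in>words I n. r w < \<rho>"
proof -
  obtain n where n: "q ^ n < \<rho>" using real_arch_pow_inv[OF assms q_less_1] by blast
  have "r w < \<rho>" if "w \<in> words I n" for w
    using r_le[of w] that n by (auto simp: words_def)
  then show ?thesis by blast
qed

definition stopping_near :: "real \<Rightarrow> real \<Rightarrow> 'a \<Rightarrow> 'i list set" where
  "stopping_near R \<rho> z = {w \<in> stopping \<rho>. cyl w \<inter> cball z (R * \<rho>) \<noteq> {}}"

lemma stopping_count:
  obtains M :: nat where "0 < M"
    "\<And>\<rho> z. 0 < \<rho> \<Longrightarrow> \<rho> \<le> 1 \<Longrightarrow> finite (stopping_near R \<rho> z) \<and>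
       card (stopping_near R \<rho> z) \<le> M"
proof -
  obtain c where c: "0 < c" "\<And>\<rho> w. \<rho> \<le> 1 \<Longrightarrow> w \<in> stopping \<rho> \<Longrightarrow> c * \<rho> \<le> r w"
    using stopping_lower by blast
  \<comment> \<open>In \<open>count\<close> the same constant bounds the radius of the ball and the
    ratio of \<open>\<rho>\<close> to \<open>r w\<close>, so it has to dominate both
    \<open>R\<close> and the constant of \<open>stopping_lower\<close>.\<close>
  define R' where "R' = max R (1 / c)"
  obtain M :: nat where M: "\<forall>\<rho> z S. 0 < \<rho> \<longrightarrow> finite S \<longrightarrow>
      (\<forall>w\<in>S. set w \<subseteq> I \<and> \<rho> \<le> R' * r w \<and> r w \<le> \<rho> \<and> cyl w \<inter> cball z (R' * \<rho>) \<noteq> {}) \<longrightarrow>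
      (\<forall>u\<in>S. \<forall>v. u @ v \<in> S \<longrightarrow> v = []) \<longrightarrow> card S \<le> M"
    using count[of R'] by (rule exE)
  have le: "card S \<le> M"
    if "0 < \<rho>" "\<rho> \<le> 1" "finite S" "S \<subseteq> stopping_near R \<rho> z" for \<rho> z S
  proof (rule M[THEN spec[of _ \<rho>], THEN spec[of _ z], THEN spec[of _ S], THEN mp, OF that(1),
        THEN mp, OF that(3), THEN mp, THEN mp])
    have ball: "cball z (R * \<rho>) \<subseteq> cball z (R' * \<rho>)"
      using that by (auto intro!: subset_cball mult_right_mono simp: R'_def)
    have ratio: "\<rho> \<le> R' * r w" if "w \<in> S" for w
    proof -
      have w: "w \<in> stopping \<rho>" using \<open>S \<subseteq> _\<close> that by (auto simp: stopping_near_def)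
      then have "\<rho> \<le> 1 / c * r w" using c(2)[OF \<open>\<rho> \<le> 1\<close> w] c(1) by (simp add: field_simps)
      also have "\<dots> \<le> R' * r w" using w r_pos[of w]
        by (intro mult_right_mono) (auto simp: R'_def stopping_def)
      finally show ?thesis .
    qed
    show "\<forall>w\<in>S. set w \<subseteq> I \<and> \<rho> \<le> R' * r w \<and> r w \<le> \<rho> \<and> cyl w \<inter> cball z (R' * \<rho>) \<noteq> {}"
    proof (intro ballI conjI)
      fix w assume w: "w \<in> S"
      then have "w \<in> stopping \<rho>" "cyl w \<inter> cball z (R * \<rho>) \<noteq> {}"
        using that(4) by (auto simp: stopping_near_def)
      then show "set w \<subseteq> I" "r w \<le> \<rho>" "cyl w \<inter> cball z (R' * \<rho>) \<noteq> {}"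
        using ball by (auto simp: stopping_def)
      show "\<rho> \<le> R' * r w" using w by (rule ratio)
    qed
    show "\<forall>u\<in>S. \<forall>v. u @ v \<in> S \<longrightarrow> v = []"
      using that(4) stopping_antichain unfolding stopping_near_def by blast
  qed
  have "finite (stopping_near R \<rho> z) \<and>
      card (stopping_near R \<rho> z) \<le> Suc M" (is "finite ?A \<and> _")
    if "0 < \<rho>" "\<rho> \<le> 1" for \<rho> z
  proof -
    \<comment> \<open>An infinite set has \<open>card\<close> 0, so the bound on finite subsets must
      first rule it out; \<open>Suc M\<close> elements already exceed that bound.\<close>
    have "finite ?A"
    proof (rule ccontr)
      assume "infinite ?A"
      then obtain S where "S \<subseteq> ?A" "finite S" "card S = Suc M"
        using infinite_arbitrarily_large by blast
      then show False using le[OF that] by fastforce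
    qed
    then show ?thesis using le[OF that, of ?A] by fastforce
  qed
  then show ?thesis using that[of "Suc M"] by blast
qed


section \<open>The dimension of the invariant set\<close>

text \<open>A mass distribution argument without measures: in a finite cover by balls of radii \<open>\<rho> i\<close>, the
  words of a large length \<open>L\<close> are distributed over the stopping words at the scales \<open>\<rho> i\<close>.\<close>

lemma hausdorff_measure_pos:
  assumes "0 < t" "0 < c" and c: "\<And>j. c \<le> Y t j"
  shows "0 < hausdorff_measure t E"
proof -
  obtain M :: nat where "0 < M" and M: "\<And>\<rho> z. 0 < \<rho> \<Longrightarrow> \<rho> \<le> 1 \<Longrightarrow>
      finite (stopping_near 1 \<rho> z) \<and>
      card (stopping_near 1 \<rho> z) \<le> M"
    using stopping_count by blast
  \<comment> \<open>The losses of the final estimate: at most \<open>M\<close> stopping words belong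
    to a ball, and each carries at most \<open>K powr t * K powr t / c * \<rho> i powr t\<close> of
    the total \<open>Y t L\<close>. The choice of \<open>\<eta>\<close> makes
    \<open>A * (2 * \<eta>) < 1\<close>, so cheap covers cannot account for the whole sum.\<close>
  define A where "A = M * (K powr t * K powr t / c)"
  have "0 < A" using \<open>0 < M\<close> assms K_ge_1 by (simp add: A_def)
  define \<eta> where "\<eta> = min 1 (1 / A) / 3"
  have \<eta>: "0 < \<eta>" "2 * \<eta> \<le> 1" "A * (2 * \<eta>) < 1"
  proof -
    show "0 < \<eta>" "2 * \<eta> \<le> 1" using \<open>0 < A\<close> by (auto simp: \<eta>_def)
    have "A * (2 * \<eta>) \<le> A * (2 * (1 / A / 3))"
      using \<open>0 < A\<close> by (intro mult_left_mono) (auto simp: \<eta>_def)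
    also have "\<dots> < 1" using \<open>0 < A\<close> by simp
    finally show "A * (2 * \<eta>) < 1" .
  qed
  have "ennreal \<eta> \<le> hausdorff_content t 1 E"
    unfolding hausdorff_content_def
  proof (rule INF_greatest, rule ccontr)
    fix U :: "nat \<Rightarrow> 'a set"
    assume U: "U \<in> {U. E \<subseteq> (\<Union>i. U i) \<and> (\<forall>i. bounded (U i) \<and> diameter (U i) \<le> 1)}"
      and "\<not> ennreal \<eta> \<le> (\<Sum>i. hausdorff_gauge t (U i))"
    then have lt: "(\<Sum>i. hausdorff_gauge t (U i)) < ennreal \<eta>" by simp
    define \<gamma> where "\<gamma> i = (if U i = {} then 0 else diameter (U i) powr t)" for i
    have gauge: "hausdorff_gauge t (U i) = ennreal (\<gamma> i)" for i
      using assms by (simp add: hausdorff_gauge_def \<gamma>_def)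
    have \<gamma>_nonneg: "0 \<le> \<gamma> i" for i by (simp add: \<gamma>_def)
    have \<gamma>_sum: "sum \<gamma> J < \<eta>" if "finite J" for J
    proof -
      have "ennreal (sum \<gamma> J) = (\<Sum>i\<in>J. hausdorff_gauge t (U i))"
        by (simp add: gauge \<gamma>_nonneg)
      also have "\<dots> \<le> (\<Sum>i. hausdorff_gauge t (U i))"
        using that by (intro sum_le_suminf) auto
      also note lt
      finally show ?thesis using \<gamma>_nonneg by (simp add: ennreal_less_iff sum_nonneg)
    qed
    \<comment> \<open>The extra summand makes each radius positive and larger than the diameter, so
      that open balls centred in the sets cover them. It adds at most \<open>\<eta>\<close> to the
      sum of the \<open>\<rho> i powr t\<close>.\<close>
    define \<rho> where "\<rho> i = (\<gamma> i + \<eta> * (1 / 2) ^ Suc i) powr (1 / t)" for i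
    have pos: "0 < \<gamma> i + \<eta> * (1 / 2) ^ Suc i" for i
      using \<gamma>_nonneg[of i] \<eta> by (intro add_nonneg_pos) auto
    have \<rho>_pos: "0 < \<rho> i" for i using pos[of i] by (simp add: \<rho>_def)
    have \<rho>_powr: "\<rho> i powr t = \<gamma> i + \<eta> * (1 / 2) ^ Suc i" for i
      using pos[of i] assms by (simp add: \<rho>_def powr_powr)
    have \<rho>_le_1: "\<rho> i \<le> 1" for i
    proof -
      have "\<eta> * (1 / 2) ^ Suc i \<le> \<eta> * 1" using \<eta> by (intro mult_left_mono power_le_one) auto
      moreover have "\<gamma> i < \<eta>" using \<gamma>_sum[of "{i}"] by simp
      ultimately have "\<gamma> i + \<eta> * (1 / 2) ^ Suc i \<le> 1" using \<eta> by linarith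
      then show ?thesis unfolding \<rho>_def using pos[of i] assms by (intro powr_le1) auto
    qed
    define z where "z i = (SOME x. x \<in> U i)" for i
    define B where "B i = (if U i = {} then {} else ball (z i) (\<rho> i))" for i
    have "U i \<subseteq> B i" for i
    proof
      fix x assume x: "x \<in> U i"
      then have ne: "U i \<noteq> {}" and z: "z i \<in> U i" by (auto simp: z_def intro: someI)
      have d: "0 \<le> diameter (U i)" "dist (z i) x \<le> diameter (U i)"
        using diameter_ge_0[of "U i"] diameter_bounded_bound[of "U i" "z i" x] U x z by auto
      have "diameter (U i) = (diameter (U i) powr t) powr (1 / t)"
        using d assms by (simp add: powr_powr)
      also have "\<dots> < \<rho> i"
        unfolding \<rho>_def using ne \<eta> assms by (intro powr_less_mono2) (auto simp: \<gamma>_def)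
      finally show "x \<in> B i" using d ne by (simp add: B_def)
    qed
    then have "E \<subseteq> (\<Union>i. B i)" using U by blast
    moreover have "open (B i)" for i by (simp add: B_def)
    ultimately obtain J where J: "finite J" "E \<subseteq> (\<Union>i\<in>J. B i)"
      by (rule_tac compactE_image[OF compact_E, of UNIV B]) auto
    \<comment> \<open>Below this bound a word has a stopping prefix at every scale
      \<open>\<rho> i\<close> with \<open>i \<in> J\<close>. Inserting 1 keeps the argument of
      \<open>Min\<close> nonempty.\<close>
    define \<rho>0 where "\<rho>0 = Min (insert 1 (\<rho> ` J))"
    have "0 < \<rho>0" using J \<rho>_pos by (simp add: \<rho>0_def)
    then obtain L where L: "\<forall>w\<in>words I L. r w < \<rho>0"
      using r_less by blast
    define S where "S i = stopping_near 1 (\<rho> i) (z i)" for i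
    \<comment> \<open>The length bound keeps \<open>L - length v\<close> from being truncated when
      \<open>Y t (L - length v)\<close> is compared with \<open>Y t L\<close>.\<close>
    define S' where "S' i = {v \<in> S i. length v \<le> L}" for i
    have S: "finite (S' i)" "card (S' i) \<le> M" for i
    proof -
      have "finite (S i)" "card (S i) \<le> M"
        using M[OF \<rho>_pos \<rho>_le_1] by (auto simp: S_def)
      moreover have "S' i \<subseteq> S i" by (auto simp: S'_def)
      ultimately show "finite (S' i)" "card (S' i) \<le> M"
        using finite_subset card_mono[of "S i" "S' i"] by auto
    qed
    have decomp: "\<exists>i v u. i \<in> J \<and> v \<in> S' i \<and> u \<in> words I (L - length v) \<and> w = v @ u"
      if w: "w \<in> words I L" for w
    proof -
      \<comment> \<open>One point per cylinder decides to which ball the word is charged. A word may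
        have several decompositions, so only an inequality of sums follows.\<close>
      obtain x where x: "x \<in> E" using E_nonempty by blast
      have wI: "set w \<subseteq> I" using w by (simp add: words_def)
      then have "word_map f w x \<in> E" using x by (rule word_map_in_E)
      then obtain i where i: "i \<in> J" "word_map f w x \<in> B i" using J by blast
      have "r w \<le> \<rho> i" using L w i(1) J by (force simp: \<rho>0_def)
      then obtain v u where vu: "w = v @ u" "v \<in> stopping (\<rho> i)"
        using stopping_prefix[OF wI] by blast
      have u: "set u \<subseteq> I" using wI vu by simp
      have "word_map f w x = word_map f v (word_map f u x)"
        using vu by (simp add: word_map_append)
      then have "word_map f w x \<in> cyl v" using word_map_in_E[OF u x] by blast
      moreover have "word_map f w x \<in> cball (z i) (\<rho> i)"
        using i(2) by (auto simp: B_def split: if_splits)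
      ultimately have "v \<in> S' i" using vu w by (auto simp: S'_def S_def stopping_near_def words_def)
      moreover have "u \<in> words I (L - length v)" using vu w by (auto simp: words_def)
      ultimately show ?thesis using i vu by blast
    qed
    have "Y t L \<le> (\<Sum>(i, v, u)\<in>(SIGMA i:J. SIGMA v:S' i. words I (L - length v)). r (v @ u) powr t)"
      unfolding Y_def
    proof (rule sum_le_included[where i = "\<lambda>(i, v, u). v @ u"])
      show "\<forall>w\<in>words I L. \<exists>y\<in>SIGMA i:J. SIGMA v:S' i. words I (L - length v).
          (case y of (i, v, u) \<Rightarrow> v @ u) = w \<and>
          r w powr t \<le> (case y of (i, v, u) \<Rightarrow> r (v @ u) powr t)"
        using decomp by fastforce
    qed (use J S finite_words[OF finite_I] in auto)
    also have "\<dots> = (\<Sum>i\<in>J. \<Sum>v\<in>S' i. Z t v (L - length v))"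
      using J S finite_words[OF finite_I] by (simp add: sum.Sigma Z_def)
    also have "\<dots> \<le> (\<Sum>i\<in>J. \<Sum>v\<in>S' i. (K powr t * K powr t / c) * (\<rho> i powr t * Y t L))"
    proof (intro sum_mono)
      fix i v assume v: "v \<in> S' i"
      then have vI: "set v \<subseteq> I" "r v \<le> \<rho> i" "length v \<le> L"
        by (auto simp: S'_def S_def stopping_near_def stopping_def)
      \<comment> \<open>The lower bound \<open>c\<close> on \<open>Y t (length v)\<close> is needed
        here: with supermultiplicativity it bounds the shorter sum by the full one, uniformly in
        \<open>v\<close>.\<close>
      have "c * Y t (L - length v) \<le> Y t (length v) * Y t (L - length v)"
        using c Y_pos[of t] by (intro mult_right_mono) (auto intro: less_imp_le)
      also have "\<dots> \<le> K powr t * Y t L"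
        using Y_add_bounds(1)[of t "length v" "L - length v"] vI assms by simp
      finally have a: "Y t (L - length v) \<le> K powr t * Y t L / c"
        using assms by (simp add: field_simps)
      have "Z t v (L - length v) \<le> K powr t * (r v powr t * Y t (L - length v))"
        using Z_bounds(2) vI assms by auto
      also have "\<dots> \<le> K powr t * (\<rho> i powr t * (K powr t * Y t L / c))"
        using a vI r_pos[of v] assms Y_pos[of t]
        by (intro mult_left_mono mult_mono powr_mono2) (auto intro: less_imp_le)
      finally show "Z t v (L - length v) \<le> (K powr t * K powr t / c) * (\<rho> i powr t * Y t L)"
        by (simp add: mult_ac)
    qed
    also have "\<dots> \<le> (\<Sum>i\<in>J. A * (\<rho> i powr t * Y t L))"
    proof (rule sum_mono)
      fix i assume "i \<in> J"
      have "real (card (S' i)) * ((K powr t * K powr t / c) * (\<rho> i powr t * Y t L)) \<le>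
          real M * ((K powr t * K powr t / c) * (\<rho> i powr t * Y t L))"
        using S(2)[of i] Y_pos[of t L] assms by (intro mult_right_mono) auto
      then show "(\<Sum>v\<in>S' i. (K powr t * K powr t / c) * (\<rho> i powr t * Y t L)) \<le> A * (\<rho> i powr t * Y t L)"
        by (simp add: A_def mult_ac)
    qed
    also have "\<dots> = A * (\<Sum>i\<in>J. \<rho> i powr t) * Y t L"
      by (simp add: sum_distrib_left sum_distrib_right mult_ac)
    finally have "1 \<le> A * (\<Sum>i\<in>J. \<rho> i powr t)" using Y_pos[of t L] by simp
    also have "(\<Sum>i\<in>J. \<rho> i powr t) \<le> 2 * \<eta>"
    proof -
      have "(\<Sum>i\<in>J. (1 / 2 :: real) ^ Suc i) \<le> (\<Sum>i. (1 / 2) ^ Suc i)"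
        using J power_half_series by (intro sum_le_suminf) (auto simp: sums_iff)
      also have "\<dots> = 1" using power_half_series by (simp add: sums_iff)
      finally have "\<eta> * (\<Sum>i\<in>J. (1 / 2 :: real) ^ Suc i) \<le> \<eta> * 1" using \<eta> by (intro mult_left_mono) auto
      then show ?thesis
        using \<gamma>_sum[OF J(1)] unfolding \<rho>_powr by (simp only: sum.distrib sum_distrib_left)
    qed
    then have "A * (\<Sum>i\<in>J. \<rho> i powr t) \<le> A * (2 * \<eta>)" using \<open>0 < A\<close> by (intro mult_left_mono) auto
    finally show False using \<eta> by simp
  qed
  then have "ennreal \<eta> \<le> hausdorff_measure t E"
    using hausdorff_content_le_measure[of 1 t E] by simp
  then show ?thesis using \<eta> by (metis ennreal_less_zero_iff order_less_le_trans)
qed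

text \<open>If \<open>Y s n\<close> exceeded \<open>K powr s\<close>, continuity in the exponent
  would give \<open>Y t n > K powr t\<close> for some \<open>t > s\<close>. Quasi-multiplicativity
  then yields \<open>Y t j \<le> Y t (n + j)\<close>, so the sums stay away from 0 and
  \<open>E\<close> has positive measure in a dimension above its own.\<close>

lemma Y_le_of_dim:
  assumes "hausdorff_dim E = ereal s"
  shows "Y s n \<le> K powr s"
proof (rule ccontr)
  assume "\<not> Y s n \<le> K powr s"
  then have gt: "0 < Y s n - K powr s" by simp
  have "0 \<le> s" using assms by (rule hausdorff_dim_nonneg)
  have "((\<lambda>t. Y t n - K powr t) \<longlongrightarrow> Y s n - K powr s) (at_right s)"
    unfolding Y_def using K_ge_1
    by (intro tendsto_intros) (auto simp: words_def dest: r_pos)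
  then have "eventually (\<lambda>t. 0 < Y t n - K powr t) (at_right s)"
    using gt by (rule order_tendstoD)
  then obtain b where b: "s < b" "\<And>t. s < t \<Longrightarrow> t < b \<Longrightarrow> 0 < Y t n - K powr t"
    by (auto simp: eventually_at_right[of s "s + 1"])
  define t where "t = (s + b) / 2"
  have t: "s < t" "K powr t < Y t n" using b(1) b(2)[of t] by (auto simp: t_def)
  have "0 < t" using t \<open>0 \<le> s\<close> by simp
  have "0 < n"
    using t K_ge_1 ge_one_powr_ge_zero[of K t] \<open>0 < t\<close> by (cases n) (auto simp: Y_0)
  \<comment> \<open>Shifts by \<open>n\<close> do not decrease \<open>Y t\<close>, so its values at
    the residues modulo \<open>n\<close> bound all others from below.\<close>
  define c where "c = Min (Y t ` {..<n})"
  have c: "0 < c" "\<And>j. j < n \<Longrightarrow> c \<le> Y t j"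
    using \<open>0 < n\<close> Y_pos by (auto simp: c_def Min_gr_iff lessThan_empty_iff)
  have step: "Y t j \<le> Y t (n + j)" for j
  proof -
    have "K powr t * Y t j \<le> Y t n * Y t j"
      using t Y_pos[of t j] by (intro mult_right_mono) auto
    also have "\<dots> \<le> K powr t * Y t (n + j)"
      using \<open>0 < t\<close> by (intro Y_add_bounds) auto
    finally show ?thesis using K_ge_1 by simp
  qed
  have "c \<le> Y t j" for j
  proof (induction j rule: less_induct)
    case (less j)
    show ?case
    proof (cases "j < n")
      case False
      then have "c \<le> Y t (j - n)" using less \<open>0 < n\<close> by simp
      also have "\<dots> \<le> Y t j" using step[of "j - n"] False by simp
      finally show ?thesis .
    qed (use c in auto)
  qed
  then have "0 < hausdorff_measure t E" using hausdorff_measure_pos \<open>0 < t\<close> c(1) by blast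
  then show False using hausdorff_measure_above_dim[OF assms t(1)] by simp
qed

section \<open>Covers by cylinders and subsets of positive measure\<close>

lemma hausdorff_content_le_words:
  assumes "0 \<le> s" "G \<subseteq> words I n" "A \<subseteq> (\<Union>w\<in>G. cyl w)" "D * q ^ n \<le> \<delta>"
  shows "hausdorff_content s \<delta> A \<le> ennreal (D powr s * (\<Sum>w\<in>G. r w powr s))"
proof -
  have fin: "finite G" using assms(2) finite_words[OF finite_I] finite_subset by blast
  have GI: "set w \<subseteq> I" if "w \<in> G" for w using that assms(2) by (auto simp: words_def)
  have le: "D * r w \<le> \<delta>" if "w \<in> G" for w
  proof -
    have "r w \<le> q ^ n" using r_le[OF GI[OF that]] that assms(2) by (auto simp: words_def)
    then have "D * r w \<le> D * q ^ n" using D_ge_1 by (intro mult_left_mono) auto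
    then show ?thesis using assms by simp
  qed
  have "0 \<le> D * q ^ n" using D_ge_1 q_pos by simp
  then have "0 \<le> \<delta>" using assms by linarith
  moreover have "bounded (cyl w) \<and> diameter (cyl w) \<le> \<delta>" if "w \<in> G" for w
    using bounded_cyl[OF GI] diameter_cyl_le[OF GI] le that by (meson order_trans)
  ultimately have "hausdorff_content s \<delta> A \<le> (\<Sum>w\<in>G. hausdorff_gauge s (cyl w))"
    using fin assms(3) by (intro hausdorff_content_le_finite_cover)
  also have "\<dots> \<le> (\<Sum>w\<in>G. ennreal ((D * r w) powr s))"
    using assms(1) D_ge_1 GI r_pos
    by (intro sum_mono hausdorff_gauge_le) (auto intro: bounded_cyl diameter_cyl_le)
  also have "\<dots> = ennreal (\<Sum>w\<in>G. (D * r w) powr s)" by simp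
  also have "(\<Sum>w\<in>G. (D * r w) powr s) = D powr s * (\<Sum>w\<in>G. r w powr s)"
    using D_ge_1 GI r_pos by (simp add: sum_distrib_left powr_mult less_imp_le)
  finally show ?thesis .
qed

lemma D_power_less:
  assumes "0 < \<delta>"
  obtains n where "\<And>m. n \<le> m \<Longrightarrow> D * q ^ m \<le> \<delta>"
proof -
  obtain n where "q ^ n < \<delta> / D"
    using real_arch_pow_inv[OF _ q_less_1] assms D_ge_1 by force
  then have n: "D * q ^ n \<le> \<delta>" using D_ge_1 by (simp add: field_simps)
  have "D * q ^ m \<le> \<delta>" if "n \<le> m" for m
  proof -
    have "D * q ^ m \<le> D * q ^ n"
      using that D_ge_1 q_pos q_less_1 by (intro mult_left_mono power_decreasing) auto
    then show ?thesis using n by simp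
  qed
  then show ?thesis using that by blast
qed

text \<open>Positive measure means positive content at some scale \<open>\<delta>\<close>. The
  cylinders of any sufficiently large level are admissible covers at that scale, which bounds
  \<open>Y s (n + j)\<close> from below; submultiplicativity up to a constant transfers the bound to
  every \<open>Y s j\<close>.\<close>

lemma Y_lower:
  assumes "0 \<le> s" "0 < hausdorff_measure s E"
  obtains c where "0 < c" "\<And>j. c \<le> Y s j"
proof -
  obtain \<delta> where \<delta>: "0 < \<delta>" "0 < hausdorff_content s \<delta> E"
    using assms(2) by (auto simp: hausdorff_measure_def less_SUP_iff)
  obtain n where n: "D * q ^ n \<le> \<delta>" "\<And>m. n \<le> m \<Longrightarrow> D * q ^ m \<le> \<delta>"
    using D_power_less[OF \<delta>(1)] by blast
  have le: "hausdorff_content s \<delta> E \<le> ennreal (D powr s * Y s m)" if "n \<le> m" for m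
    unfolding Y_def using assms(1) cyl_cover[of m] n(2)[OF that]
    by (intro hausdorff_content_le_words) auto
  define e where "e = enn2real (hausdorff_content s \<delta> E)"
  have "hausdorff_content s \<delta> E < top" using le[of n] by (simp add: order_le_less_trans)
  then have "0 < e" and e: "hausdorff_content s \<delta> E = ennreal e"
    using \<delta> by (auto simp: e_def enn2real_positive_iff)
  have "e / (D powr s * (K powr s * Y s n)) \<le> Y s j" for j
  proof -
    have "e \<le> D powr s * Y s (n + j)"
      using le[of "n + j"] e D_ge_1 Y_pos[of s "n + j"] by (simp add: ennreal_le_iff)
    also have "\<dots> \<le> D powr s * (K powr s * (Y s n * Y s j))"
      using assms by (intro mult_left_mono Y_add_bounds) auto
    finally show ?thesis using D_ge_1 K_ge_1 Y_pos[of s n] by (simp add: field_simps)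
  qed
  moreover have "0 < e / (D powr s * (K powr s * Y s n))"
    using \<open>0 < e\<close> D_ge_1 K_ge_1 Y_pos[of s n] by simp
  ultimately show ?thesis using that by blast
qed

text \<open>Otherwise the sums over the words whose cylinders meet \<open>E'\<close> would decay geometrically.\<close>

lemma word_with_dense_subcylinders:
  assumes dim: "hausdorff_dim E = ereal s" and "E' \<subseteq> E" and pos: "0 < hausdorff_measure s E'"
  shows "\<exists>w. set w \<subseteq> I \<and> (\<forall>u\<in>words I k. cyl (w @ u) \<inter> E' \<noteq> {})"
proof (rule ccontr)
  assume neg: "\<not> ?thesis"
  have no: "\<exists>u\<in>words I k. cyl (w @ u) \<inter> E' = {}" if "set w \<subseteq> I" for w
    using that neg by auto
  have s: "0 \<le> s" using dim by (rule hausdorff_dim_nonneg)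
  \<comment> \<open>Blocks must have positive length, also for \<open>k = 0\<close>, so that the
    words of \<open>j\<close> blocks get arbitrarily long.\<close>
  define l where "l = Suc k"
  have "\<exists>u\<in>words I l. cyl (w @ u) \<inter> E' = {}" if "set w \<subseteq> I" for w
  proof -
    from no[OF that] obtain u where u: "u \<in> words I k" "cyl (w @ u) \<inter> E' = {}" by blast
    obtain i where i: "i \<in> I" using I_nonempty by blast
    have "cyl ((w @ u) @ [i]) \<subseteq> cyl (w @ u)"
      using word_map_in_E[of "[i]"] i by (auto simp: word_map_append simp del: append_assoc)
    then have "u @ [i] \<in> words I l" "cyl (w @ (u @ [i])) \<inter> E' = {}"
      using u i by (auto simp: words_def l_def)
    then show ?thesis by blast
  qed
  then obtain u0 where u0: "\<And>w. set w \<subseteq> I \<Longrightarrow> u0 w \<in> words I l"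
      "\<And>w. set w \<subseteq> I \<Longrightarrow> cyl (w @ u0 w) \<inter> E' = {}"
    by metis
  have "0 < hausdorff_measure s E"
    using pos hausdorff_measure_mono[OF \<open>E' \<subseteq> E\<close>] by (rule less_le_trans)
  then obtain c where c: "0 < c" "\<And>j. c \<le> Y s j" using Y_lower s by blast
  obtain c1 where c1: "0 < c1" "c1 \<le> 1" "\<And>u. u \<in> words I l \<Longrightarrow> c1 \<le> r u"
    using r_min by blast
  \<comment> \<open>The share of the mass of \<open>w\<close> guaranteed to each extension by a
    block: \<open>c1 / K\<close> bounds the loss in the ratio, \<open>c\<close> and
    \<open>K powr s\<close> bound the sums \<open>Y s\<close> from both sides, and the other factors
    come from \<open>Z_bounds\<close>. The minimum with 1 keeps \<open>1 - \<kappa>\<close>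
    nonnegative.\<close>
  define \<kappa> where "\<kappa> = min 1 ((c1 / K) powr s * c / (K powr s * (K powr s * K powr s)))"
  have \<kappa>: "0 < \<kappa>" "\<kappa> \<le> 1" using c c1 K_ge_1 by (auto simp: \<kappa>_def)
  have child: "\<kappa> * Z s w n \<le> Z s (w @ u) m" if "set w \<subseteq> I" "u \<in> words I l" for w u n m
  proof -
    have wu: "set (w @ u) \<subseteq> I" using that by (auto simp: words_def)
    have "r w * c1 / K \<le> r w * r u / K"
      using c1 that r_pos[OF that(1)] K_ge_1 by (intro divide_right_mono mult_left_mono) auto
    also have "\<dots> \<le> r (w @ u)" using r_append[OF wu] by simp
    finally have "(r w * (c1 / K)) powr s \<le> r (w @ u) powr s"
      using s c1 r_pos[OF that(1)] K_ge_1 by (intro powr_mono2) auto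
    then have "r w powr s * (c1 / K) powr s \<le> r (w @ u) powr s"
      using r_pos[OF that(1)] c1 K_ge_1 by (subst (asm) powr_mult) auto
    then have "r w powr s * (c1 / K) powr s * c \<le> r (w @ u) powr s * Y s m"
      using c r_pos[OF that(1)] c1 K_ge_1 by (intro mult_mono) auto
    also have "\<dots> \<le> K powr s * Z s (w @ u) m" using Z_bounds(1)[OF s wu] .
    finally have lower: "r w powr s * (c1 / K) powr s * c / K powr s \<le> Z s (w @ u) m"
      using K_ge_1 by (simp add: field_simps)
    have "Z s w n \<le> K powr s * (r w powr s * Y s n)" using Z_bounds(2)[OF s that(1)] .
    also have "\<dots> \<le> K powr s * (r w powr s * K powr s)"
      using Y_le_of_dim[OF dim] by (intro mult_left_mono) auto
    finally have "\<kappa> * Z s w n \<le>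
        ((c1 / K) powr s * c / (K powr s * (K powr s * K powr s))) * (K powr s * (r w powr s * K powr s))"
      using \<kappa> c c1 K_ge_1 Z_nonneg[of s w n] by (intro mult_mono) (auto simp: \<kappa>_def)
    also have "\<dots> = r w powr s * (c1 / K) powr s * c / K powr s"
      using K_ge_1 by (simp add: field_simps)
    finally show ?thesis using lower by simp
  qed
  define G where "G j = {w \<in> words I (j * l). cyl w \<inter> E' \<noteq> {}}" for j
  \<comment> \<open>Surviving words of \<open>j\<close> blocks are weighed by their extensions
    \<open>p\<close> blocks deeper. Lengthening the words by a block while lowering \<open>p\<close>
    by one leaves the total depth fixed, so \<open>Z_add\<close> applies without loss and every step
    gains the full factor \<open>1 - \<kappa>\<close>.\<close>
  define S where "S j p = (\<Sum>w\<in>G j. Z s w (p * l))" for j p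
  have finG: "finite (G j)" for j using finite_words[OF finite_I] by (simp add: G_def)
  have GI: "set w \<subseteq> I" if "w \<in> G j" for w j using that by (auto simp: G_def words_def)
  have step: "S (Suc j) p \<le> (1 - \<kappa>) * S j (Suc p)" for j p
  proof -
    have "S (Suc j) p \<le> (\<Sum>(w, u)\<in>(SIGMA w:G j. words I l - {u0 w}). Z s (w @ u) (p * l))"
      unfolding S_def
    proof (rule sum_le_included[where i = "\<lambda>(w, u). w @ u"])
      show "\<forall>x\<in>G (Suc j). \<exists>y\<in>SIGMA w:G j. words I l - {u0 w}.
          (case y of (w, u) \<Rightarrow> w @ u) = x \<and>
          Z s x (p * l) \<le> (case y of (w, u) \<Rightarrow> Z s (w @ u) (p * l))"
      proof
        fix x assume x: "x \<in> G (Suc j)"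
        define w u where "w = take (j * l) x" and "u = drop (j * l) x"
        have xwu: "x = w @ u" by (simp add: w_def u_def)
        have w: "w \<in> words I (j * l)" and u: "u \<in> words I l"
          using x by (auto simp: G_def words_def w_def u_def dest: in_set_takeD in_set_dropD)
        have "set u \<subseteq> I" using u by (simp add: words_def)
        then have "cyl x \<subseteq> cyl w" using word_map_in_E by (auto simp: xwu word_map_append)
        then have "w \<in> G j" using x w by (auto simp: G_def)
        moreover have "u \<noteq> u0 w" using x u0(2)[OF GI[OF \<open>w \<in> G j\<close>]] by (auto simp: G_def xwu)
        ultimately show "\<exists>y\<in>SIGMA w:G j. words I l - {u0 w}.
          (case y of (w, u) \<Rightarrow> w @ u) = x \<and>
          Z s x (p * l) \<le> (case y of (w, u) \<Rightarrow> Z s (w @ u) (p * l))"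
          using u by (intro bexI[of _ "(w, u)"]) (auto simp: xwu)
      qed
    qed (use finG finite_words[OF finite_I] Z_nonneg in auto)
    also have "\<dots> = (\<Sum>w\<in>G j. \<Sum>u\<in>words I l - {u0 w}. Z s (w @ u) (p * l))"
      using finG finite_words[OF finite_I] by (simp add: sum.Sigma)
    also have "\<dots> \<le> (\<Sum>w\<in>G j. (1 - \<kappa>) * Z s w (Suc p * l))"
    proof (rule sum_mono)
      fix w assume w: "w \<in> G j"
      have "(\<Sum>u\<in>words I l - {u0 w}. Z s (w @ u) (p * l)) =
          Z s w (l + p * l) - Z s (w @ u0 w) (p * l)"
        using u0(1)[OF GI[OF w]] finite_words[OF finite_I] by (simp add: Z_add sum_diff1)
      also have "\<dots> \<le> (1 - \<kappa>) * Z s w (Suc p * l)"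
        using child[OF GI[OF w] u0(1)[OF GI[OF w]], of "Suc p * l" "p * l"] by (simp add: algebra_simps)
      finally show "(\<Sum>u\<in>words I l - {u0 w}. Z s (w @ u) (p * l)) \<le> (1 - \<kappa>) * Z s w (Suc p * l)" .
    qed
    finally show ?thesis by (simp add: S_def sum_distrib_left)
  qed
  have iter: "S j p \<le> (1 - \<kappa>) ^ j * S 0 (p + j)" for j p
  proof (induction j arbitrary: p)
    case (Suc j)
    have "(1 - \<kappa>) * S j (Suc p) \<le> (1 - \<kappa>) * ((1 - \<kappa>) ^ j * S 0 (Suc p + j))"
      using \<kappa> by (intro mult_left_mono Suc) auto
    then show ?case using step[of j p] by (simp add: mult_ac)
  qed simp
  have "S 0 n \<le> Y s (n * l)" for n
  proof -
    have "S 0 n \<le> (\<Sum>w\<in>{[]}. Z s w (n * l))"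
      unfolding S_def using Z_nonneg by (intro sum_mono2) (auto simp: G_def)
    then show ?thesis by (simp add: Z_Nil)
  qed
  then have S0: "S 0 n \<le> K powr s" for n using Y_le_of_dim[OF dim] order_trans by blast
  have content: "hausdorff_content s \<delta> E' = 0" if "0 < \<delta>" for \<delta>
  proof -
    obtain n0 where n0: "\<And>m. n0 \<le> m \<Longrightarrow> D * q ^ m \<le> \<delta>" using D_power_less[OF \<open>0 < \<delta>\<close>] by blast
    have "hausdorff_content s \<delta> E' \<le> ennreal (D powr s * ((1 - \<kappa>) ^ n * K powr s))" if "n0 \<le> n" for n
    proof -
      have "n \<le> n * l" by (simp add: l_def)
      then have "D * q ^ (n * l) \<le> \<delta>" using n0[of "n * l"] that by linarith
      moreover have "E' \<subseteq> (\<Union>w\<in>G n. cyl w)"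
        using \<open>E' \<subseteq> E\<close> cyl_cover[of "n * l"] by (fastforce simp: G_def)
      ultimately have "hausdorff_content s \<delta> E' \<le> ennreal (D powr s * (\<Sum>w\<in>G n. r w powr s))"
        using s by (intro hausdorff_content_le_words[where n = "n * l"]) (auto simp: G_def)
      also have "(\<Sum>w\<in>G n. r w powr s) = S n 0" by (simp add: S_def Z_0)
      also have "ennreal (D powr s * S n 0) \<le> ennreal (D powr s * ((1 - \<kappa>) ^ n * K powr s))"
      proof (intro ennreal_leI mult_left_mono)
        have "(1 - \<kappa>) ^ n * S 0 n \<le> (1 - \<kappa>) ^ n * K powr s"
          using S0 \<kappa> by (intro mult_left_mono) auto
        then show "S n 0 \<le> (1 - \<kappa>) ^ n * K powr s" using iter[of n 0] by simp
      qed auto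
      finally show ?thesis .
    qed
    moreover have "(\<lambda>n. ennreal (D powr s * ((1 - \<kappa>) ^ n * K powr s))) \<longlonglongrightarrow> ennreal (D powr s * (0 * K powr s))"
      using \<kappa> by (intro tendsto_ennrealI tendsto_intros LIMSEQ_realpow_zero) auto
    ultimately have "hausdorff_content s \<delta> E' \<le> ennreal (D powr s * (0 * K powr s))"
      by (intro LIMSEQ_le_const) auto
    then show ?thesis by simp
  qed
  then have "hausdorff_measure s E' = 0" by (simp add: hausdorff_measure_def)
  then show False using pos by simp
qed

end


section \<open>Bilipschitz embeddings of quasi-self-similar sets\<close>

text \<open>Read \<open>hits w v u\<close> as: the cylinder of \<open>u\<close> contains a point that \<open>g\<^sub>v\<inverse> \<circ> h \<circ> f\<^sub>w\<close> maps into \<open>F\<close>. Either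
  a single \<open>v\<close> suffices for all \<open>k\<close>, or there is an \<open>m\<close> such that each \<open>v\<close> misses a cylinder of order \<open>m\<close>;
  passing to that cylinder removes one \<open>v\<close> and worsens the ratios only by a factor depending on \<open>m\<close>.\<close>

lemma single_cylinder:
  fixes hits :: "'i list \<Rightarrow> 'j list \<Rightarrow> 'i list \<Rightarrow> bool" and B :: real
  assumes A: "quasi_self_similar I f E r K C q"
    and r'_pos: "\<And>v. v \<in> X \<Longrightarrow> 0 < r' v" and "0 < B"
    and hits_app: "\<And>w v u0 u. set w \<subseteq> I \<Longrightarrow> set u0 \<subseteq> I \<Longrightarrow> set u \<subseteq> I \<Longrightarrow>
      hits w v (u0 @ u) \<Longrightarrow> hits w v u0 \<and> hits (w @ u0) v u"
    and many: "\<And>k. \<exists>w Q. set w \<subseteq> I \<and> finite Q \<and> card Q \<le> n \<and> Q \<subseteq> X \<and>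
      (\<forall>v\<in>Q. r w \<le> B * r' v \<and> r' v \<le> B * r w) \<and> (\<forall>u\<in>words I k. \<exists>v\<in>Q. hits w v u)"
  shows "\<exists>B>0. \<forall>m. \<exists>w v. set w \<subseteq> I \<and> v \<in> X \<and> r w \<le> B * r' v \<and> r' v \<le> B * r w \<and>
      (\<forall>u\<in>words I m. hits w v u)"
  using \<open>0 < B\<close> many
proof (induction n arbitrary: B)
  interpret quasi_self_similar I f E r K C q by (rule A)
  case 0
  \<comment> \<open>With no \<open>v\<close> available even the empty word cannot be hit, so the
    hypothesis is contradictory.\<close>
  from 0(2)[of 0] show ?case by auto
next
  interpret quasi_self_similar I f E r K C q by (rule A)
  case (Suc n)
  show ?case
  proof (cases "\<forall>m. \<exists>w v. set w \<subseteq> I \<and> v \<in> X \<and> r w \<le> B * r' v \<and> r' v \<le> B * r w \<and>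
      (\<forall>u\<in>words I m. hits w v u)")
    case True
    then show ?thesis using Suc.prems(1) by blast
  next
    case False
    then obtain m where m: "\<And>w v. set w \<subseteq> I \<Longrightarrow> v \<in> X \<Longrightarrow> r w \<le> B * r' v \<Longrightarrow> r' v \<le> B * r w \<Longrightarrow>
        \<exists>u\<in>words I m. \<not> hits w v u"
      by blast
    obtain c where c: "0 < c" "c \<le> 1" "\<And>u. u \<in> words I m \<Longrightarrow> c \<le> r u" using r_min by blast
    \<comment> \<open>Appending a word of length \<open>m\<close> changes the ratio by a factor
      between \<open>c / K\<close> and \<open>K\<close>.\<close>
    define B' where "B' = B * K / c"
    have "0 < B'" using Suc.prems(1) c K_ge_1 by (simp add: B'_def)
    then show ?thesis
    proof (rule Suc.IH)
      fix k
      \<comment> \<open>Order \<open>m + k\<close> leaves \<open>k\<close> letters after the move to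
        \<open>w @ u0\<close>. By \<open>hits_app\<close>, the discarded \<open>v0\<close> cannot
        hit any extension of the word \<open>u0\<close> that it misses.\<close>
      obtain w Q where w: "set w \<subseteq> I" and Q: "finite Q" "card Q \<le> Suc n" "Q \<subseteq> X"
        and ratio: "\<And>v. v \<in> Q \<Longrightarrow> r w \<le> B * r' v \<and> r' v \<le> B * r w"
        and hits: "\<And>u. u \<in> words I (m + k) \<Longrightarrow> \<exists>v\<in>Q. hits w v u"
        using Suc.prems(2)[of "m + k"] by blast
      obtain v0 where v0: "v0 \<in> Q" using hits words_nonempty[of "m + k"] by blast
      obtain u0 where u0: "u0 \<in> words I m" "\<not> hits w v0 u0"
        using m[OF w, of v0] ratio[OF v0] v0 Q by blast
      have u0I: "set u0 \<subseteq> I" using u0 by (simp add: words_def)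
      have wu0: "set (w @ u0) \<subseteq> I" using w u0I by simp
      have "card (Q - {v0}) \<le> n" using Q v0 by simp
      moreover have "r (w @ u0) \<le> B' * r' v \<and> r' v \<le> B' * r (w @ u0)" if "v \<in> Q" for v
      proof
        have "0 < r w" "0 < r' v" using r_pos[OF w] r'_pos Q that by auto
        have "r (w @ u0) \<le> K * (r w * r u0)" using r_append[OF wu0] by simp
        also have "\<dots> \<le> K * (B * r' v * 1)"
          using ratio[OF that] r_le_1[OF u0I] r_pos[OF u0I] K_ge_1 \<open>0 < r w\<close>
          by (intro mult_left_mono mult_mono) auto
        also have "\<dots> \<le> B' * r' v"
          using c K_ge_1 Suc.prems(1) \<open>0 < r' v\<close> by (simp add: B'_def field_simps)
        finally show "r (w @ u0) \<le> B' * r' v" .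
        have "r w * c / K \<le> r w * r u0 / K"
          using c u0 \<open>0 < r w\<close> K_ge_1 by (intro divide_right_mono mult_left_mono) auto
        also have "\<dots> \<le> r (w @ u0)" using r_append[OF wu0] by simp
        finally have "B * (r w * c / K) \<le> B * r (w @ u0)"
          using Suc.prems(1) by (intro mult_left_mono) auto
        then have "B * r w \<le> B' * r (w @ u0)" using c K_ge_1 by (simp add: B'_def field_simps)
        then show "r' v \<le> B' * r (w @ u0)" using ratio[OF that] by linarith
      qed
      moreover have "\<exists>v\<in>Q - {v0}. hits (w @ u0) v u" if "u \<in> words I k" for u
      proof -
        have u: "set u \<subseteq> I" "u0 @ u \<in> words I (m + k)" using that u0 by (auto simp: words_def)
        then obtain v where "v \<in> Q" "hits w v (u0 @ u)" using hits by blast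
        then show ?thesis using hits_app[OF w u0I u(1)] u0(2) by blast
      qed
      ultimately show "\<exists>w Q. set w \<subseteq> I \<and> finite Q \<and> card Q \<le> n \<and> Q \<subseteq> X \<and>
          (\<forall>v\<in>Q. r w \<le> B' * r' v \<and> r' v \<le> B' * r w) \<and> (\<forall>u\<in>words I k. \<exists>v\<in>Q. hits w v u)"
        using wu0 Q by (intro exI[of _ "w @ u0"] exI[of _ "Q - {v0}"]) auto
    qed
  qed
qed

text \<open>The space of all functions into the compact \<open>F\<close> is compact in the product
  topology. Each approximate inequality involves two coordinates only and is a closed condition; as
  \<open>\<epsilon>\<close> decreases, a late \<open>\<psi> n\<close> satisfies finitely many of
  these families at once. A point common to all of them has no additive error left.\<close>

lemma bilipschitz_map_limit:
  fixes \<psi> :: "nat \<Rightarrow> 'a::metric_space \<Rightarrow> 'b::metric_space"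
  assumes "compact F" "0 < L" "\<epsilon> \<longlonglongrightarrow> 0" "decseq \<epsilon>"
    and \<psi>_in: "\<And>m x. x \<in> E \<Longrightarrow> \<psi> m x \<in> F"
    and \<psi>: "\<And>m x y. x \<in> E \<Longrightarrow> y \<in> E \<Longrightarrow>
      dist (\<psi> m x) (\<psi> m y) \<le> L * (dist x y + \<epsilon> m) \<and> dist x y \<le> L * dist (\<psi> m x) (\<psi> m y) + \<epsilon> m"
  shows "\<exists>h. bilipschitz_map h E F"
proof (cases "E = {}")
  case True
  then show ?thesis using \<open>0 < L\<close> by (auto simp: bilipschitz_map_def)
next
  case False
  then obtain a where a: "a \<in> E" by blast
  define T where "T m = {\<phi> :: 'a \<Rightarrow> 'b. \<forall>x\<in>E. \<forall>y\<in>E.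
      dist (\<phi> x) (\<phi> y) \<le> L * (dist x y + \<epsilon> m) \<and> dist x y \<le> L * dist (\<phi> x) (\<phi> y) + \<epsilon> m}" for m
  let ?P = "PiE UNIV (\<lambda>_::'a. F)"
  have "compactin (product_topology (\<lambda>_::'a. euclidean :: 'b topology) UNIV) ?P"
    using \<open>compact F\<close> by (simp add: compactin_PiE)
  then have cpt: "compact ?P" by (simp add: euclidean_product_topology)
  have clo: "closed (T m)" for m
    unfolding T_def Ball_def
    by (intro closed_Collect_all closed_Collect_imp closed_Collect_conj closed_Collect_le
        continuous_intros continuous_on_product_coordinates) auto
  have fip: "?P \<inter> (\<Inter>m\<in>J. T m) \<noteq> {}" if "finite J" for J
  proof -
    obtain n where n: "\<forall>m\<in>J. m \<le> n" using \<open>finite J\<close> finite_nat_set_iff_bounded_le by blast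
    \<comment> \<open>The product runs over the whole type, so a default value in \<open>F\<close>
      is used outside \<open>E\<close>.\<close>
    define \<phi> where "\<phi> x = (if x \<in> E then \<psi> n x else \<psi> n a)" for x
    have "\<phi> \<in> ?P" using \<psi>_in a by (auto simp: \<phi>_def)
    moreover have "\<phi> \<in> T m" if "m \<in> J" for m
    proof -
      have le: "\<epsilon> n \<le> \<epsilon> m" using n that \<open>decseq \<epsilon>\<close> by (auto simp: decseq_def)
      have "dist (\<psi> n x) (\<psi> n y) \<le> L * (dist x y + \<epsilon> m) \<and> dist x y \<le> L * dist (\<psi> n x) (\<psi> n y) + \<epsilon> m"
        if "x \<in> E" "y \<in> E" for x y
      proof -
        have "L * (dist x y + \<epsilon> n) \<le> L * (dist x y + \<epsilon> m)"
          using le \<open>0 < L\<close> by (intro mult_left_mono) auto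
        then show ?thesis using \<psi>[OF that, of n] le by linarith
      qed
      then show ?thesis by (simp add: T_def \<phi>_def)
    qed
    ultimately show ?thesis by blast
  qed
  have "?P \<inter> (\<Inter>m\<in>UNIV. T m) \<noteq> {}"
    by (rule compact_imp_fip_image[OF cpt clo fip])
  then obtain \<phi> where "\<phi> \<in> ?P" and T: "\<phi> \<in> (\<Inter>m\<in>UNIV. T m)" by blast
  then have \<phi>: "\<phi> x \<in> F" "\<phi> \<in> T m" for x m using PiE_mem[of \<phi> UNIV "\<lambda>_. F" x] by auto
  have "dist (\<phi> x) (\<phi> y) \<le> L * dist x y \<and> dist x y / L \<le> dist (\<phi> x) (\<phi> y)" if "x \<in> E" "y \<in> E" for x y
  proof
    have lim: "(\<lambda>m. L * (dist x y + \<epsilon> m)) \<longlonglongrightarrow> L * (dist x y + 0)"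
        "(\<lambda>m. L * dist (\<phi> x) (\<phi> y) + \<epsilon> m) \<longlonglongrightarrow> L * dist (\<phi> x) (\<phi> y) + 0"
      by (intro tendsto_intros \<open>\<epsilon> \<longlonglongrightarrow> 0\<close>)+
    have "dist (\<phi> x) (\<phi> y) \<le> L * (dist x y + 0)"
      using \<phi>(2) that by (intro LIMSEQ_le_const[OF lim(1)]) (auto simp: T_def)
    then show "dist (\<phi> x) (\<phi> y) \<le> L * dist x y" by simp
    have "dist x y \<le> L * dist (\<phi> x) (\<phi> y) + 0"
      using \<phi>(2) that by (intro LIMSEQ_le_const[OF lim(2)]) (auto simp: T_def)
    then show "dist x y / L \<le> dist (\<phi> x) (\<phi> y)" using \<open>0 < L\<close> by (simp add: field_simps)
  qed
  then show ?thesis using \<phi>(1) \<open>0 < L\<close> unfolding bilipschitz_map_def by blast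
qed

theorem quasi_self_similar_embedding:
  assumes A: "quasi_self_similar I f E r K C q" and B: "quasi_self_similar J g F r' K' C' q'"
    and dim: "hausdorff_dim E = ereal s" and "E' \<subseteq> E" and pos: "0 < hausdorff_measure s E'"
    and h: "bilipschitz_map h E' F"
  shows "\<exists>h'. bilipschitz_map h' E F"
proof -
  interpret A: quasi_self_similar I f E r K C q by (rule A)
  interpret B: quasi_self_similar J g F r' K' C' q' by (rule B)
  obtain L where hF: "\<And>x. x \<in> E' \<Longrightarrow> h x \<in> F" and "0 < L"
    and L: "\<And>x y. x \<in> E' \<Longrightarrow> y \<in> E' \<Longrightarrow> dist x y / L \<le> dist (h x) (h y) \<and> dist (h x) (h y) \<le> L * dist x y"
    using h unfolding bilipschitz_map_def by blast
  define hits where "hits w v u \<longleftrightarrow>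
      (\<exists>x\<in>A.cyl u. word_map f w x \<in> E' \<and> h (word_map f w x) \<in> B.cyl v)" for w v u
  have hits_app: "hits w v u0 \<and> hits (w @ u0) v u"
    if "set w \<subseteq> I" "set u0 \<subseteq> I" "set u \<subseteq> I" "hits w v (u0 @ u)" for w v u0 u
  proof -
    from that(4) obtain x where "x \<in> E" "word_map f w (word_map f u0 (word_map f u x)) \<in> E'"
        "h (word_map f w (word_map f u0 (word_map f u x))) \<in> B.cyl v"
      by (auto simp: hits_def word_map_append)
    moreover from this have "word_map f u x \<in> E" using A.word_map_in_E that by blast
    ultimately show ?thesis unfolding hits_def by (fastforce simp: word_map_append)
  qed
  obtain M :: nat where "0 < M" and M: "\<And>\<rho> z. 0 < \<rho> \<Longrightarrow> \<rho> \<le> 1 \<Longrightarrow>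
      finite (B.stopping_near (L * A.D) \<rho> z) \<and>
      card (B.stopping_near (L * A.D) \<rho> z) \<le> M"
    using B.stopping_count by blast
  obtain c where c: "0 < c" "\<And>\<rho> v. \<rho> \<le> 1 \<Longrightarrow> v \<in> B.stopping \<rho> \<Longrightarrow> c * \<rho> \<le> r' v"
    using B.stopping_lower by blast
  define b where "b = max 1 (1 / c)"
  have "0 < b" by (simp add: b_def)
  have many: "\<exists>w Q. set w \<subseteq> I \<and> finite Q \<and> card Q \<le> M \<and> Q \<subseteq> {v. set v \<subseteq> J} \<and>
      (\<forall>v\<in>Q. r w \<le> b * r' v \<and> r' v \<le> b * r w) \<and> (\<forall>u\<in>words I k. \<exists>v\<in>Q. hits w v u)" for k
  proof -
    obtain w where "set w \<subseteq> I \<and> (\<forall>u\<in>words I k. A.cyl (w @ u) \<inter> E' \<noteq> {})"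
      using A.word_with_dense_subcylinders[OF dim \<open>E' \<subseteq> E\<close> pos, of k] by (rule exE)
    then have w: "set w \<subseteq> I" "\<And>u. u \<in> words I k \<Longrightarrow> A.cyl (w @ u) \<inter> E' \<noteq> {}" by auto
    have \<rho>: "0 < r w" "r w \<le> 1" using A.r_pos A.r_le_1 w by auto
    have sub: "A.cyl (w @ u) \<subseteq> A.cyl w" if "u \<in> words I k" for u
      using that A.word_map_in_E by (auto simp: word_map_append words_def)
    obtain x0 where x0: "x0 \<in> A.cyl w" "x0 \<in> E'"
      using w(2) sub A.words_nonempty[of k] by blast
    \<comment> \<open>The part of \<open>E'\<close> in the cylinder of \<open>w\<close> has diameter
      at most \<open>A.D * r w\<close>, so its image lies in the ball of radius
      \<open>L * A.D * r w\<close> about \<open>h x0\<close>.\<close>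
    define Q where "Q = B.stopping_near (L * A.D) (r w) (h x0)"
    have "finite Q" "card Q \<le> M" using M[OF \<rho>] by (auto simp: Q_def)
    moreover have "r w \<le> b * r' v \<and> r' v \<le> b * r w" if "v \<in> Q" for v
    proof
      have v: "v \<in> B.stopping (r w)" using that by (simp add: Q_def B.stopping_near_def)
      then have "0 < r' v" using B.r_pos by (auto simp: B.stopping_def)
      have "r w \<le> 1 / c * r' v" using c(2)[OF \<rho>(2) v] c(1) by (simp add: field_simps)
      also have "\<dots> \<le> b * r' v" using \<open>0 < r' v\<close> by (intro mult_right_mono) (auto simp: b_def)
      finally show "r w \<le> b * r' v" .
      have "r' v \<le> 1 * r w" using v by (simp add: B.stopping_def)
      also have "\<dots> \<le> b * r w" using \<rho> by (intro mult_right_mono) (auto simp: b_def)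
      finally show "r' v \<le> b * r w" .
    qed
    moreover have "\<exists>v\<in>Q. hits w v u" if u: "u \<in> words I k" for u
    proof -
      obtain y where y: "y \<in> A.cyl (w @ u)" "y \<in> E'" using w(2)[OF u] by blast
      then obtain x where x: "x \<in> A.cyl u" "y = word_map f w x" by (auto simp: word_map_append)
      have "dist (h x0) (h y) \<le> L * dist x0 y" using L x0 y by blast
      also have "\<dots> \<le> L * (A.D * r w)"
        using A.cyl_dist_le[OF w(1) x0(1)] y sub[OF u] \<open>0 < L\<close> by (intro mult_left_mono) auto
      finally have dist: "h y \<in> cball (h x0) (L * A.D * r w)" by (simp add: mult_ac)
      obtain n where n: "\<forall>v\<in>words J n. r' v < r w"
        using B.r_less[OF \<rho>(1)] by blast
      obtain v where v: "v \<in> words J n" "h y \<in> B.cyl v" using hF[OF y(2)] B.cyl_cover[of n] by blast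
      have vJ: "set v \<subseteq> J" using v by (simp add: words_def)
      obtain v1 v2 where v12: "v = v1 @ v2" "v1 \<in> B.stopping (r w)"
        using B.stopping_prefix[OF vJ less_imp_le[OF n[rule_format, OF v(1)]]] by blast
      have "h y \<in> B.cyl v1"
        using v(2) vJ B.word_map_in_E[of v2] by (auto simp: v12(1) word_map_append)
      then have "v1 \<in> Q" "hits w v1 u" using v12 dist x y by (auto simp: Q_def B.stopping_near_def hits_def)
      then show ?thesis by blast
    qed
    ultimately show ?thesis
      using w(1) by (intro exI[of _ w] exI[of _ Q]) (auto simp: Q_def B.stopping_near_def B.stopping_def)
  qed
  have "\<exists>b>0. \<forall>m. \<exists>w v. set w \<subseteq> I \<and> v \<in> {v. set v \<subseteq> J} \<and>
      r w \<le> b * r' v \<and> r' v \<le> b * r w \<and> (\<forall>u\<in>words I m. hits w v u)"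
    by (rule single_cylinder[OF A _ \<open>0 < b\<close> hits_app many]) (use B.r_pos in auto)
  then obtain b where "0 < b" and b: "\<forall>m. \<exists>w v. set w \<subseteq> I \<and> v \<in> {v. set v \<subseteq> J} \<and>
      r w \<le> b * r' v \<and> r' v \<le> b * r w \<and> (\<forall>u\<in>words I m. hits w v u)"
    by blast
  obtain w v where w: "\<And>m. set (w m) \<subseteq> I" and v: "\<And>m. set (v m) \<subseteq> J"
    and ratio: "\<And>m. r (w m) \<le> b * r' (v m)" "\<And>m. r' (v m) \<le> b * r (w m)"
    and hits: "\<And>m u. u \<in> words I m \<Longrightarrow> hits (w m) (v m) u"
    using b by simp metis
  \<comment> \<open>Each \<open>x\<close> is moved to a nearby \<open>y\<close> at which
    \<open>h\<close> is available after \<open>word_map f (w m)\<close>. The point \<open>p\<close>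
    is a chosen preimage under \<open>word_map g (v m)\<close>, so no inverse function has to be
    defined.\<close>
  have "\<exists>y p. y \<in> E \<and> p \<in> F \<and> dist x y \<le> A.D * q ^ m \<and> word_map f (w m) y \<in> E' \<and>
      word_map g (v m) p = h (word_map f (w m) y)" if "x \<in> E" for m x
  proof -
    obtain u where u: "u \<in> words I m" "x \<in> A.cyl u" using \<open>x \<in> E\<close> A.cyl_cover[of m] by blast
    have uI: "set u \<subseteq> I" "length u = m" using u by (auto simp: words_def)
    obtain y where y: "y \<in> A.cyl u" "word_map f (w m) y \<in> E'" "h (word_map f (w m) y) \<in> B.cyl (v m)"
      using hits[OF u(1)] by (auto simp: hits_def)
    have "dist x y \<le> A.D * r u" using A.cyl_dist_le uI u y by blast
    also have "\<dots> \<le> A.D * q ^ m"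
      using A.r_le[OF uI(1)] uI A.D_ge_1 by (intro mult_left_mono) auto
    finally show ?thesis using y A.word_map_in_E[OF uI(1)] by (metis imageE)
  qed
  then have "\<forall>m x. \<exists>y p. x \<in> E \<longrightarrow> y \<in> E \<and> p \<in> F \<and> dist x y \<le> A.D * q ^ m \<and>
      word_map f (w m) y \<in> E' \<and> word_map g (v m) p = h (word_map f (w m) y)" by blast
  then have "\<exists>y p. \<forall>m x. x \<in> E \<longrightarrow> y m x \<in> E \<and> p m x \<in> F \<and> dist x (y m x) \<le> A.D * q ^ m \<and>
      word_map f (w m) (y m x) \<in> E' \<and> word_map g (v m) (p m x) = h (word_map f (w m) (y m x))"
    by (simp only: choice_iff)
  then obtain y p where "\<forall>m x. x \<in> E \<longrightarrow> y m x \<in> E \<and> p m x \<in> F \<and> dist x (y m x) \<le> A.D * q ^ m \<and>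
      word_map f (w m) (y m x) \<in> E' \<and> word_map g (v m) (p m x) = h (word_map f (w m) (y m x))"
    by (elim exE)
  then have yp: "y m x \<in> E" "p m x \<in> F" "dist x (y m x) \<le> A.D * q ^ m"
      "word_map f (w m) (y m x) \<in> E'" "word_map g (v m) (p m x) = h (word_map f (w m) (y m x))"
    if "x \<in> E" for m x using that by auto
  \<comment> \<open>One factor each for \<open>word_map f (w m)\<close>,
    \<open>word_map g (v m)\<close>, \<open>h\<close>, and the quotient of the two ratios.\<close>
  define \<Lambda> where "\<Lambda> = C * C' * L * b"
  have "0 < \<Lambda>" using A.C_ge_1 B.C_ge_1 \<open>0 < L\<close> \<open>0 < b\<close> by (simp add: \<Lambda>_def)
  \<comment> \<open>The factor 2 appears because both points of a pair are moved.\<close>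
  define \<epsilon> where "\<epsilon> m = 2 * (A.D * q ^ m)" for m
  have "\<epsilon> \<longlonglongrightarrow> 2 * (A.D * 0)"
    unfolding \<epsilon>_def using A.q_pos A.q_less_1 by (intro tendsto_intros LIMSEQ_realpow_zero) auto
  then have "\<epsilon> \<longlonglongrightarrow> 0" by simp
  moreover have "decseq \<epsilon>"
    unfolding \<epsilon>_def decseq_def using A.D_ge_1 A.q_pos A.q_less_1
    by (auto intro!: mult_left_mono power_decreasing)
  moreover have "dist (p m x) (p m x') \<le> \<Lambda> * (dist x x' + \<epsilon> m) \<and> dist x x' \<le> \<Lambda> * dist (p m x) (p m x') + \<epsilon> m"
    if x: "x \<in> E" "x' \<in> E" for m x x'
  proof -
    define d e where "d = dist (y m x) (y m x')" and "e = dist (p m x) (p m x')"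
    define \<delta> where "\<delta> = dist (word_map f (w m) (y m x)) (word_map f (w m) (y m x'))"
    define \<delta>' where "\<delta>' = dist (h (word_map f (w m) (y m x))) (h (word_map f (w m) (y m x')))"
    have pos: "0 < r (w m)" "0 < r' (v m)" using A.r_pos[OF w] B.r_pos[OF v] by auto
    have nn: "0 \<le> d" "0 \<le> e" by (auto simp: d_def e_def)
    have \<delta>: "r (w m) * d / C \<le> \<delta>" "\<delta> \<le> C * (r (w m) * d)"
      using A.bilip[OF w[of m] yp(1)[OF x(1), of m] yp(1)[OF x(2), of m]] by (auto simp: \<delta>_def d_def)
    have \<delta>': "\<delta> / L \<le> \<delta>'" "\<delta>' \<le> L * \<delta>" using L[OF yp(4)[OF x(1), of m] yp(4)[OF x(2), of m]] by (auto simp: \<delta>_def \<delta>'_def)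
    have e: "r' (v m) * e / C' \<le> \<delta>'" "\<delta>' \<le> C' * (r' (v m) * e)"
      using B.bilip[OF v[of m] yp(2)[OF x(1), of m] yp(2)[OF x(2), of m]] yp(5)[OF x(1), of m] yp(5)[OF x(2), of m]
      by (simp_all add: \<delta>'_def e_def)
    have "r' (v m) * e \<le> C' * \<delta>'" using e B.C_ge_1 by (simp add: field_simps)
    also have "\<dots> \<le> C' * (L * (C * (r (w m) * d)))"
      using \<delta> \<delta>' \<open>0 < L\<close> B.C_ge_1 by (intro mult_left_mono) (auto intro: order_trans[OF _ mult_left_mono])
    also have "\<dots> \<le> C' * (L * (C * ((b * r' (v m)) * d)))"
      using ratio nn \<open>0 < L\<close> A.C_ge_1 B.C_ge_1 by (intro mult_left_mono mult_right_mono) auto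
    finally have ed: "e \<le> \<Lambda> * d" using pos by (simp add: \<Lambda>_def mult_ac)
    have "r (w m) * d \<le> C * \<delta>" using \<delta> A.C_ge_1 by (simp add: field_simps)
    also have "\<delta> \<le> L * \<delta>'" using \<delta>' \<open>0 < L\<close> by (simp add: field_simps)
    also have "\<delta>' \<le> C' * ((b * r (w m)) * e)"
    proof -
      have "C' * (r' (v m) * e) \<le> C' * ((b * r (w m)) * e)"
        using ratio nn B.C_ge_1 by (intro mult_left_mono mult_right_mono) auto
      then show ?thesis using e by linarith
    qed
    finally have de: "d \<le> \<Lambda> * e"
      using pos A.C_ge_1 \<open>0 < L\<close> by (simp add: \<Lambda>_def mult_ac)
    have "dist x x' \<le> dist x (y m x) + d + dist x' (y m x')"
         "d \<le> dist x (y m x) + dist x x' + dist x' (y m x')"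
      unfolding d_def by metric+
    then have "dist x x' \<le> d + \<epsilon> m" "d \<le> dist x x' + \<epsilon> m"
      using yp(3)[OF x(1), of m] yp(3)[OF x(2), of m] by (auto simp: \<epsilon>_def)
    moreover from this have "\<Lambda> * d \<le> \<Lambda> * (dist x x' + \<epsilon> m)"
      using \<open>0 < \<Lambda>\<close> by (intro mult_left_mono) auto
    ultimately show ?thesis using ed de by (auto simp: e_def)
  qed
  ultimately show ?thesis
    using bilipschitz_map_limit[OF B.compact_E \<open>0 < \<Lambda>\<close>, of \<epsilon> E p] yp(2) by blast
qed


section \<open>Expanding injective maps\<close>

lemma continuous_on_of_derivatives:
  assumes "\<And>z. z \<in> B \<Longrightarrow> \<exists>D. (g has_derivative D) (at z) \<and> Q D"
  shows "continuous_on B g"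
proof (intro continuous_at_imp_continuous_on ballI)
  fix z assume "z \<in> B"
  then obtain D where "(g has_derivative D) (at z)" using assms by blast
  then show "isCont g z" by (rule has_derivative_continuous)
qed

text \<open>A lower bound on derivatives gives no lower bound on distances by integrating
  \<open>g\<close> along a segment. The mean value inequality is therefore applied to the inverse,
  which requires a convex set in the image.\<close>

lemma inverse_lipschitz_on_convex:
  fixes g :: "'a::euclidean_space \<Rightarrow> 'a"
  assumes "open B" "0 < m" and inj: "inj_on g B"
    and der: "\<And>z. z \<in> B \<Longrightarrow> \<exists>D. (g has_derivative D) (at z) \<and> (\<forall>v. m * norm v \<le> norm (D v))"
    and "convex S" "S \<subseteq> g ` B" "g y \<in> S" "g z \<in> S" "y \<in> B" "z \<in> B"
  shows "m * dist y z \<le> dist (g y) (g z)"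
proof -
  define \<phi> where "\<phi> = the_inv_into B g"
  have \<phi>: "\<phi> (g z) = z" if "z \<in> B" for z
    unfolding \<phi>_def using inj that by (rule the_inv_into_f_f)
  have cont: "continuous_on B g"
    by (rule continuous_on_of_derivatives[OF der])
  have "\<exists>D. (\<phi> has_derivative D) (at u) \<and> onorm D \<le> 1 / m" if "u \<in> S" for u
  proof -
    obtain z where z: "z \<in> B" "u = g z" using \<open>u \<in> S\<close> \<open>S \<subseteq> g ` B\<close> by blast
    obtain D where D: "(g has_derivative D) (at z)" "\<And>v. m * norm v \<le> norm (D v)"
      using der[OF z(1)] by blast
    have lin: "linear D" using D(1) by (rule has_derivative_linear)
    have "inj D"
    proof (rule linear_injective_0[THEN iffD2, OF lin], intro allI impI)
      fix v assume "D v = 0"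
      then show "v = 0" using D(2)[of v] \<open>0 < m\<close> by (simp add: mult_le_0_iff)
    qed
    then obtain D' where D': "linear D'" "\<And>v. D (D' v) = v"
      using linear_injective_isomorphism[OF lin] by blast
    have "(\<phi> has_derivative D') (at (g z))"
      by (rule has_derivative_inverse_strong[OF \<open>open B\<close> z(1) cont \<phi> D(1)]) (auto simp: D')
    moreover have "onorm D' \<le> 1 / m"
    proof (rule onorm_bound)
      show "norm (D' v) \<le> 1 / m * norm v" for v
        using D(2)[of "D' v"] \<open>0 < m\<close> by (simp add: D' field_simps)
    qed (use \<open>0 < m\<close> in simp)
    ultimately show ?thesis using z by blast
  qed
  then have "\<forall>u\<in>S. \<exists>D. (\<phi> has_derivative D) (at u) \<and> onorm D \<le> 1 / m" by blast
  then obtain D where D: "\<forall>u\<in>S. (\<phi> has_derivative D u) (at u) \<and> onorm (D u) \<le> 1 / m"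
    by (rule bchoice[THEN exE])
  have "norm (\<phi> (g y) - \<phi> (g z)) \<le> 1 / m * norm (g y - g z)"
  proof (rule differentiable_bound[OF \<open>convex S\<close>])
    show "(\<phi> has_derivative D u) (at u within S)" "onorm (D u) \<le> 1 / m" if "u \<in> S" for u
      using D that by (auto intro: has_derivative_at_withinI)
  qed fact+
  then show ?thesis using \<phi> \<open>y \<in> B\<close> \<open>z \<in> B\<close> \<open>0 < m\<close> by (simp add: dist_norm field_simps)
qed

text \<open>Let \<open>R\<close> be the distance from \<open>g x\<close> to the complement of the
  image. The inverse is Lipschitz with constant \<open>1 / m\<close> on the open ball of radius
  \<open>R\<close>, so if \<open>R < m * \<delta>\<close>, that ball lies in the image of the
  compact ball of radius \<open>R / m < \<delta>\<close>. So does its closure, including the nearest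
  point of the complement, a contradiction.\<close>

lemma expanding_map_ball:
  fixes g :: "'a::euclidean_space \<Rightarrow> 'a"
  assumes "0 < \<delta>" "0 < m" and inj: "inj_on g (ball x \<delta>)"
    and der: "\<And>z. z \<in> ball x \<delta> \<Longrightarrow> \<exists>D. (g has_derivative D) (at z) \<and> (\<forall>v. m * norm v \<le> norm (D v))"
  shows "ball (g x) (m * \<delta>) \<subseteq> g ` ball x \<delta>"
proof (rule ccontr)
  let ?G = "g ` ball x \<delta>"
  assume "\<not> ball (g x) (m * \<delta>) \<subseteq> ?G"
  then obtain p where p: "dist (g x) p < m * \<delta>" "p \<in> - ?G" by (meson ComplI mem_ball subsetI)
  have cont: "continuous_on (ball x \<delta>) g"
    by (rule continuous_on_of_derivatives[OF der])
  then have "open ?G" using inj by (intro invariance_of_domain) auto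
  then have "closed (- ?G)" by (rule closed_Compl)
  then obtain p0 where p0: "p0 \<in> - ?G" "infdist (g x) (- ?G) = dist (g x) p0"
    using p(2) infdist_attains_inf by blast
  define R where "R = dist (g x) p0"
  have "R < m * \<delta>" using infdist_le[OF p(2), of "g x"] p p0 by (simp add: R_def)
  then have R: "R / m < \<delta>" using \<open>0 < m\<close> by (simp add: field_simps)
  have "g x \<in> ?G" using \<open>0 < \<delta>\<close> by simp
  then have "0 < R" using p0 by (auto simp: R_def)
  have ball: "ball (g x) R \<subseteq> ?G"
  proof
    fix u assume "u \<in> ball (g x) R"
    then have "\<not> infdist (g x) (- ?G) \<le> dist (g x) u" by (simp add: p0 R_def)
    then show "u \<in> ?G" using infdist_le[of u "- ?G" "g x"] by blast
  qed
  have "ball (g x) R \<subseteq> g ` cball x (R / m)"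
  proof
    fix u assume u: "u \<in> ball (g x) R"
    then obtain z where z: "z \<in> ball x \<delta>" "u = g z" using ball by blast
    have "m * dist x z \<le> dist (g x) (g z)"
      using u z ball \<open>0 < \<delta>\<close> \<open>0 < R\<close>
      by (intro inverse_lipschitz_on_convex[OF _ \<open>0 < m\<close> inj der, of "ball (g x) R"]) auto
    also have "\<dots> \<le> R" using u z by simp
    finally have "dist x z \<le> R / m" using \<open>0 < m\<close> by (simp add: field_simps)
    then show "u \<in> g ` cball x (R / m)" using z by auto
  qed
  moreover have "closed (g ` cball x (R / m))"
    using R by (intro compact_imp_closed compact_continuous_image continuous_on_subset[OF cont]) auto
  ultimately have "closure (ball (g x) R) \<subseteq> g ` cball x (R / m)" by (rule closure_minimal)
  then have "p0 \<in> g ` cball x (R / m)" using \<open>0 < R\<close> by (auto simp: R_def)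
  then show False using p0 R by auto
qed

text \<open>This excludes near collisions with points \<open>y\<close> far from \<open>x\<close>:
  the image of \<open>ball x \<delta>\<close> already fills
  \<open>ball (g x) (m * \<delta>)\<close>, so by injectivity on \<open>V\<close> only points of
  \<open>ball x \<delta>\<close> are sent there.\<close>

lemma expanding_map_dist:
  fixes g :: "'a::euclidean_space \<Rightarrow> 'a"
  assumes "0 < \<delta>" "0 < m" "ball x \<delta> \<subseteq> V" and inj: "inj_on g V" and "y \<in> V"
    and der: "\<And>z. z \<in> ball x \<delta> \<Longrightarrow> \<exists>D. (g has_derivative D) (at z) \<and> (\<forall>v. m * norm v \<le> norm (D v))"
  shows "m * min \<delta> (dist x y) \<le> dist (g x) (g y)"
proof (cases "dist (g x) (g y) < m * \<delta>")
  case False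
  have "m * min \<delta> (dist x y) \<le> m * \<delta>" using \<open>0 < m\<close> by (intro mult_left_mono) auto
  then show ?thesis using False by simp
next
  case True
  have inj': "inj_on g (ball x \<delta>)" using inj \<open>ball x \<delta> \<subseteq> V\<close> by (rule inj_on_subset)
  have sub: "ball (g x) (m * \<delta>) \<subseteq> g ` ball x \<delta>"
    using expanding_map_ball[OF \<open>0 < \<delta>\<close> \<open>0 < m\<close> inj' der] .
  have "g y \<in> g ` ball x \<delta>" using True sub by auto
  then have "y \<in> ball x \<delta>" using inj_on_image_mem_iff[OF inj \<open>y \<in> V\<close> \<open>ball x \<delta> \<subseteq> V\<close>] by simp
  then have "m * dist x y \<le> dist (g x) (g y)"
    using True sub \<open>0 < \<delta>\<close> \<open>0 < m\<close>
    by (intro inverse_lipschitz_on_convex[OF _ \<open>0 < m\<close> inj' der, of "ball (g x) (m * \<delta>)"]) auto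
  moreover have "m * min \<delta> (dist x y) \<le> m * dist x y" using \<open>0 < m\<close> by (intro mult_left_mono) auto
  ultimately show ?thesis by linarith
qed

lemma card_disjoint_balls:
  fixes p :: "'i \<Rightarrow> 'a::euclidean_space"
  assumes "finite S" "0 < e" "0 \<le> R" "disjoint_family_on (\<lambda>w. ball (p w) e) S"
    and "\<And>w. w \<in> S \<Longrightarrow> ball (p w) e \<subseteq> ball z R"
  shows "real (card S) \<le> (R / e) ^ DIM('a)"
proof -
  let ?u = "measure lborel (ball (0 :: 'a) 1)"
  have fin: "ball c r \<in> fmeasurable lborel" for c :: 'a and r
    using emeasure_lborel_ball_finite[of c r] by (intro fmeasurableI) auto
  have "real (card S) * (e ^ DIM('a) * ?u) = (\<Sum>w\<in>S. measure lborel (ball (p w) e))"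
    using \<open>0 < e\<close> by (simp add: content_ball_conv_unit_ball[of e])
  also have "\<dots> = measure lborel (\<Union>w\<in>S. ball (p w) e)"
    using assms(1,4) fin
    by (intro measure_finite_Union[symmetric]) (auto simp: fmeasurable_def less_top)
  also have "\<dots> \<le> measure lborel (ball z R)"
    using assms(1,5) fin by (intro measure_mono_fmeasurable) auto
  also have "\<dots> = R ^ DIM('a) * ?u" using \<open>0 \<le> R\<close> by (rule content_ball_conv_unit_ball)
  finally have "real (card S) * e ^ DIM('a) \<le> R ^ DIM('a)"
    using content_ball_pos[of 1 "0 :: 'a"] by simp
  then show ?thesis using \<open>0 < e\<close> by (simp add: power_divide field_simps)
qed


section \<open>Conformal systems\<close>

text \<open>Conformality is kept only as the statement that the derivative multiplies every norm by
  \<open>lam i x\<close>. The contraction constant \<open>L\<close> is separate from the derivative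
  bound \<open>q\<close> because \<open>V\<close> need not be convex.\<close>

locale conformal_system =
  fixes I :: "'i set" and V :: "'a::euclidean_space set" and f :: "'i \<Rightarrow> 'a \<Rightarrow> 'a"
    and lam :: "'i \<Rightarrow> 'a \<Rightarrow> real" and \<gamma> H L c q :: real
  assumes finite_I: "finite I" and I_nonempty: "I \<noteq> {}"
    and open_V: "open V" and connected_V: "connected V"
    and maps: "i \<in> I \<Longrightarrow> x \<in> V \<Longrightarrow> f i x \<in> V"
    and inj: "i \<in> I \<Longrightarrow> inj_on (f i) V"
    and deriv: "i \<in> I \<Longrightarrow> x \<in> V \<Longrightarrow> \<exists>D. (f i has_derivative D) (at x) \<and> (\<forall>v. norm (D v) = lam i x * norm v)"
    and c_pos: "0 < c" and q_less_1: "q < 1"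
    and lam_bounds: "i \<in> I \<Longrightarrow> x \<in> V \<Longrightarrow> c \<le> lam i x \<and> lam i x \<le> q"
    and \<gamma>_pos: "0 < \<gamma>" and H_nonneg: "0 \<le> H"
    and holder: "i \<in> I \<Longrightarrow> x \<in> V \<Longrightarrow> y \<in> V \<Longrightarrow> \<bar>lam i x - lam i y\<bar> \<le> H * dist x y powr \<gamma>"
    and L_pos: "0 < L" and L_less_1: "L < 1"
    and contract: "i \<in> I \<Longrightarrow> x \<in> V \<Longrightarrow> y \<in> V \<Longrightarrow> dist (f i x) (f i y) \<le> L * dist x y"
begin

text \<open>By the chain rule, the factor by which the derivative of \<open>word_map f w\<close> at
  \<open>x\<close> scales norms.\<close>

primrec lamw :: "'i list \<Rightarrow> 'a \<Rightarrow> real" where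
  "lamw [] x = 1"
| "lamw (i # w) x = lam i (word_map f w x) * lamw w x"

lemma word_map_in_V: "set w \<subseteq> I \<Longrightarrow> x \<in> V \<Longrightarrow> word_map f w x \<in> V"
  by (induction w) (auto intro: maps)

lemma inj_word_map: "set w \<subseteq> I \<Longrightarrow> inj_on (word_map f w) V"
proof (induction w)
  case (Cons i w)
  then have "inj_on (f i) V" "word_map f w ` V \<subseteq> V" using inj word_map_in_V by auto
  then have "inj_on (f i) (word_map f w ` V)" by (rule inj_on_subset)
  then show ?case using Cons unfolding word_map.simps by (intro comp_inj_on) auto
qed simp

lemma lamw_append: "lamw (u @ v) x = lamw u (word_map f v x) * lamw v x"
  by (induction u) (auto simp: word_map_append)

lemma lamw_pos: "set w \<subseteq> I \<Longrightarrow> x \<in> V \<Longrightarrow> 0 < lamw w x"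
proof (induction w)
  case (Cons i w)
  then have "c \<le> lam i (word_map f w x)" using lam_bounds word_map_in_V by auto
  then show ?case using Cons c_pos by simp
qed simp

lemma q_pos: "0 < q" if "V \<noteq> {}"
  using that I_nonempty lam_bounds c_pos by force

lemma lamw_le: "set w \<subseteq> I \<Longrightarrow> x \<in> V \<Longrightarrow> lamw w x \<le> q ^ length w"
proof (induction w)
  case (Cons i w)
  then have "lam i (word_map f w x) \<le> q" "lamw w x \<le> q ^ length w" "0 < lamw w x" "0 < q"
    using lam_bounds word_map_in_V lamw_pos q_pos by auto
  then show ?case by (auto intro: mult_mono)
qed simp

lemma word_map_derivative:
  "set w \<subseteq> I \<Longrightarrow> x \<in> V \<Longrightarrow>
    \<exists>D. (word_map f w has_derivative D) (at x) \<and> (\<forall>v. norm (D v) = lamw w x * norm v)"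
proof (induction w)
  case Nil
  show ?case by (rule exI[of _ "\<lambda>v. v"]) (simp add: id_def)
next
  case (Cons i w)
  then obtain D where D: "(word_map f w has_derivative D) (at x)" "\<forall>v. norm (D v) = lamw w x * norm v"
    by auto
  have "i \<in> I" "word_map f w x \<in> V" using Cons.prems word_map_in_V by auto
  from deriv[OF this] obtain D' where D': "(f i has_derivative D') (at (word_map f w x))"
      "\<forall>v. norm (D' v) = lam i (word_map f w x) * norm v" by blast
  have "(f i \<circ> word_map f w has_derivative D' \<circ> D) (at x)" using D(1) D'(1) by (rule diff_chain_at)
  moreover have "norm ((D' \<circ> D) v) = lamw (i # w) x * norm v" for v
    using D(2) D'(2) by simp
  ultimately show ?case unfolding word_map.simps by blast
qed

section \<open>Bounded distortion\<close>

lemma word_map_contract: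
  "set w \<subseteq> I \<Longrightarrow> x \<in> V \<Longrightarrow> y \<in> V \<Longrightarrow> dist (word_map f w x) (word_map f w y) \<le> L ^ length w * dist x y"
proof (induction w)
  case (Cons i w)
  have "dist (f i (word_map f w x)) (f i (word_map f w y)) \<le> L * dist (word_map f w x) (word_map f w y)"
    using Cons.prems word_map_in_V by (intro contract) auto
  also have "\<dots> \<le> L * (L ^ length w * dist x y)"
    using Cons L_pos by (intro mult_left_mono) auto
  finally show ?case by (simp add: mult_ac)
qed simp

text \<open>The factors of a letter are compared at two points at distance at most
  \<open>L ^ length w * dist x y\<close>. Hoelder continuity and the lower bound \<open>c\<close>
  make their quotient at most \<open>1 + e \<le> exp e\<close>, where \<open>e\<close> decays
  geometrically in the length of \<open>w\<close>.\<close>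

lemma lamw_distortion_sum:
  "set w \<subseteq> I \<Longrightarrow> x \<in> V \<Longrightarrow> y \<in> V \<Longrightarrow>
    lamw w x \<le> exp (H / c * dist x y powr \<gamma> * (\<Sum>j<length w. (L powr \<gamma>) ^ j)) * lamw w y"
proof (induction w)
  case (Cons i w)
  let ?x = "word_map f w x" and ?y = "word_map f w y" and ?d = "dist x y powr \<gamma>"
  let ?e = "H / c * ?d * (L powr \<gamma>) ^ length w"
  have iI: "i \<in> I" and w: "set w \<subseteq> I" using Cons.prems by auto
  have xy: "?x \<in> V" "?y \<in> V" using w Cons.prems word_map_in_V by auto
  have pos: "0 < lamw w x" "0 < lamw w y" using lamw_pos w Cons.prems by auto
  have c: "c \<le> lam i ?y" using lam_bounds[OF iI xy(2)] by simp
  have "lam i ?x \<le> lam i ?y + H * dist ?x ?y powr \<gamma>"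
    using holder[OF iI xy] by linarith
  also have "dist ?x ?y powr \<gamma> \<le> (L ^ length w * dist x y) powr \<gamma>"
    using word_map_contract[OF w Cons.prems(2,3)] \<gamma>_pos by (intro powr_mono2) auto
  also have "\<dots> = (L powr \<gamma>) ^ length w * ?d"
  proof -
    have "(L ^ length w) powr \<gamma> = (L powr \<gamma>) ^ length w"
      using L_pos by (simp add: powr_realpow[symmetric] powr_powr mult.commute)
    then show ?thesis using L_pos by (simp add: powr_mult)
  qed
  finally have "lam i ?x \<le> lam i ?y + H * ((L powr \<gamma>) ^ length w * ?d)"
    using H_nonneg by (simp add: mult_left_mono)
  also have "\<dots> = lam i ?y + c * ?e" using c_pos by (simp add: mult_ac)
  also have "\<dots> \<le> lam i ?y + lam i ?y * ?e"
    using c c_pos H_nonneg by (intro add_left_mono mult_right_mono) auto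
  also have "\<dots> = lam i ?y * (1 + ?e)" by (simp add: algebra_simps)
  also have "\<dots> \<le> lam i ?y * exp ?e" using c c_pos by (intro mult_left_mono exp_ge_add_one_self) auto
  finally have "lam i ?x * lamw w x \<le> (lam i ?y * exp ?e) *
      (exp (H / c * ?d * (\<Sum>j<length w. (L powr \<gamma>) ^ j)) * lamw w y)"
    using Cons.IH[OF w Cons.prems(2,3)] pos c c_pos by (intro mult_mono) auto
  also have "\<dots> = exp (H / c * ?d * (\<Sum>j<length (i # w). (L powr \<gamma>) ^ j)) * (lam i ?y * lamw w y)"
    by (simp add: exp_add[symmetric] distrib_left mult_ac)
  finally show ?case by simp
qed simp

lemma lamw_distortion:
  obtains K where "1 \<le> K"
    "\<And>w x y. set w \<subseteq> I \<Longrightarrow> x \<in> V \<Longrightarrow> y \<in> V \<Longrightarrow> dist x y \<le> R \<Longrightarrow> lamw w x \<le> K * lamw w y"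
proof -
  let ?\<theta> = "L powr \<gamma>"
  have \<theta>: "0 \<le> ?\<theta>" "?\<theta> < 1" using L_pos L_less_1 \<gamma>_pos powr_less_mono2[of \<gamma> L 1] by auto
  define K where "K = exp (H / c * (max R 0) powr \<gamma> * (1 / (1 - ?\<theta>)))"
  have "1 \<le> K" using H_nonneg c_pos \<theta> by (simp add: K_def)
  moreover have "lamw w x \<le> K * lamw w y"
    if "set w \<subseteq> I" "x \<in> V" "y \<in> V" "dist x y \<le> R" for w x y
  proof -
    have "(\<Sum>j<length w. ?\<theta> ^ j) \<le> 1 / (1 - ?\<theta>)"
      using \<theta> by (simp add: sum_gp_strict divide_right_mono)
    moreover have "dist x y powr \<gamma> \<le> (max R 0) powr \<gamma>" using that \<gamma>_pos by (intro powr_mono2) auto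
    ultimately have "exp (H / c * dist x y powr \<gamma> * (\<Sum>j<length w. ?\<theta> ^ j)) \<le> K"
      unfolding K_def exp_le_cancel_iff using H_nonneg c_pos \<theta>
      by (intro mult_mono mult_left_mono) (auto intro: sum_nonneg)
    then have "exp (H / c * dist x y powr \<gamma> * (\<Sum>j<length w. ?\<theta> ^ j)) * lamw w y \<le> K * lamw w y"
      using lamw_pos[of w y] that by (intro mult_right_mono) auto
    then show ?thesis using lamw_distortion_sum[OF that(1-3)] by linarith
  qed
  ultimately show ?thesis using that by blast
qed

section \<open>Uniform bilipschitz bounds on compact sets\<close>

lemma word_map_lipschitz_ball:
  assumes w: "set w \<subseteq> I" and "ball x e \<subseteq> V" "y \<in> ball x e"
    and M: "\<And>z. z \<in> ball x e \<Longrightarrow> lamw w z \<le> M"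
  shows "dist (word_map f w x) (word_map f w y) \<le> M * dist x y"
proof -
  have "\<forall>z\<in>ball x e. \<exists>D. (word_map f w has_derivative D) (at z) \<and> (\<forall>v. norm (D v) = lamw w z * norm v)"
    using word_map_derivative[OF w] assms(2) by blast
  then obtain D where D: "\<forall>z\<in>ball x e. (word_map f w has_derivative D z) (at z) \<and>
      (\<forall>v. norm (D z v) = lamw w z * norm v)"
    by (rule bchoice[THEN exE])
  have "x \<in> ball x e" using assms(3) le_less_trans[OF zero_le_dist] by auto
  have "norm (word_map f w x - word_map f w y) \<le> M * norm (x - y)"
  proof (rule differentiable_bound[OF convex_ball])
    fix z assume z: "z \<in> ball x e"
    show "(word_map f w has_derivative D z) (at z within ball x e)"
      using D z by (auto intro: has_derivative_at_withinI)
    have "0 < lamw w z" using lamw_pos w z assms(2) by blast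
    then have "0 \<le> M" using M[OF z] by linarith
    then show "onorm (D z) \<le> M"
      using D z M[OF z] by (intro onorm_bound) (auto intro: mult_right_mono)
  qed fact+
  then show ?thesis by (simp add: dist_norm)
qed

text \<open>The segment from \<open>x\<close> to \<open>y\<close> may leave \<open>V\<close>. Having
  images at distance at most a constant times \<open>lamw w a\<close>, uniformly in
  \<open>w\<close>, is an equivalence relation that holds on small balls, so connectedness extends
  it to \<open>V\<close>; no chain of balls is needed.\<close>

lemma orbit_dist_bounded:
  assumes "x \<in> V" "y \<in> V" "a \<in> V"
  shows "\<exists>D. \<forall>w. set w \<subseteq> I \<longrightarrow> dist (word_map f w x) (word_map f w y) \<le> D * lamw w a"
proof -
  define R where "R x y \<longleftrightarrow>
      (\<exists>D. \<forall>w. set w \<subseteq> I \<longrightarrow> dist (word_map f w x) (word_map f w y) \<le> D * lamw w a)" for x y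
  have "R x y"
  proof (rule connected_equivalence_relation[OF connected_V assms(1,2)])
    show "R y x" if "R x y" for x y using that by (simp add: R_def dist_commute)
    show "R x z" if "R x y" "R y z" for x y z
    proof -
      obtain D1 where 1: "\<And>w. set w \<subseteq> I \<Longrightarrow> dist (word_map f w x) (word_map f w y) \<le> D1 * lamw w a"
        using \<open>R x y\<close> by (auto simp: R_def)
      obtain D2 where 2: "\<And>w. set w \<subseteq> I \<Longrightarrow> dist (word_map f w y) (word_map f w z) \<le> D2 * lamw w a"
        using \<open>R y z\<close> by (auto simp: R_def)
      have "dist (word_map f w x) (word_map f w z) \<le> (D1 + D2) * lamw w a" if "set w \<subseteq> I" for w
        using 1[OF that] 2[OF that] dist_triangle[of "word_map f w x" "word_map f w z" "word_map f w y"]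
        by (simp add: distrib_right)
      then show ?thesis by (auto simp: R_def)
    qed
    fix x assume "x \<in> V"
    then obtain e where e: "0 < e" "ball x e \<subseteq> V" using open_V open_contains_ball by blast
    have "R x y" if "y \<in> ball x e" for y
    proof -
      obtain K where K: "1 \<le> K"
          "\<And>w z z'. set w \<subseteq> I \<Longrightarrow> z \<in> V \<Longrightarrow> z' \<in> V \<Longrightarrow> dist z z' \<le> e + dist x a \<Longrightarrow> lamw w z \<le> K * lamw w z'"
        using lamw_distortion by blast
      have "dist (word_map f w x) (word_map f w y) \<le> K * dist x y * lamw w a" if w: "set w \<subseteq> I" for w
      proof -
        have "lamw w z \<le> K * lamw w a" if "z \<in> ball x e" for z
          using that e \<open>a \<in> V\<close> dist_triangle[of z a x] by (intro K(2)[OF w]) (auto simp: dist_commute)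
        then have "dist (word_map f w x) (word_map f w y) \<le> K * lamw w a * dist x y"
          using e \<open>y \<in> ball x e\<close> w by (intro word_map_lipschitz_ball[of w x e]) auto
        then show ?thesis by (simp add: mult_ac)
      qed
      then show ?thesis by (auto simp: R_def)
    qed
    then show "\<exists>T. openin (top_of_set V) T \<and> x \<in> T \<and> (\<forall>y\<in>T. R x y)"
      using e by (intro exI[of _ "ball x e"]) (auto intro: open_subset)
  qed
  then show ?thesis by (simp add: R_def)
qed

text \<open>Points closer than the distance \<open>\<delta>\<close> from \<open>X\<close> to the
  complement of \<open>V\<close> fall under the mean value inequality. For distant points, a finite
  net and \<open>orbit_dist_bounded\<close> give the upper bound; the lower bound comes from
  \<open>expanding_map_dist\<close>, whose cutoff at \<open>\<delta>\<close> costs a factor governed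
  by the diameter of \<open>X\<close>.\<close>

lemma word_map_bilipschitz:
  assumes "compact X" "X \<subseteq> V" "a \<in> X"
  obtains C where "1 \<le> C"
    "\<And>w x y. set w \<subseteq> I \<Longrightarrow> x \<in> X \<Longrightarrow> y \<in> X \<Longrightarrow>
      lamw w a * dist x y / C \<le> dist (word_map f w x) (word_map f w y) \<and>
      dist (word_map f w x) (word_map f w y) \<le> C * (lamw w a * dist x y)"
proof -
  have aV: "a \<in> V" using assms by blast
  have "closed (- V)" "X \<inter> - V = {}" using open_V \<open>X \<subseteq> V\<close> by auto
  from separate_compact_closed[OF \<open>compact X\<close> this]
  obtain \<delta> where "0 < \<delta>" and \<delta>: "\<forall>x\<in>X. \<forall>y\<in>- V. \<delta> \<le> dist x y" by blast
  have ball: "ball x \<delta> \<subseteq> V" if "x \<in> X" for x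
  proof (rule subsetI, rule ccontr)
    fix y assume "y \<in> ball x \<delta>" "y \<notin> V"
    then show False using \<delta> that by force
  qed
  define R where "R = diameter X"
  have R: "dist x y \<le> R" if "x \<in> X" "y \<in> X" for x y
    unfolding R_def using compact_imp_bounded[OF \<open>compact X\<close>] that by (rule diameter_bounded_bound)
  have "0 \<le> R" using R[OF \<open>a \<in> X\<close> \<open>a \<in> X\<close>] by simp
  obtain K where "1 \<le> K" and
    K: "\<And>w z z'. set w \<subseteq> I \<Longrightarrow> z \<in> V \<Longrightarrow> z' \<in> V \<Longrightarrow> dist z z' \<le> R + \<delta> \<Longrightarrow> lamw w z \<le> K * lamw w z'"
    using lamw_distortion by blast
  have near: "dist z a \<le> R + \<delta>" if "x \<in> X" "z \<in> ball x \<delta>" for x z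
    using that R[OF that(1) \<open>a \<in> X\<close>] dist_triangle[of z a x] by (simp add: dist_commute)
  have lam_up: "lamw w z \<le> K * lamw w a" and lam_lo: "lamw w a \<le> K * lamw w z"
    if "set w \<subseteq> I" "x \<in> X" "z \<in> ball x \<delta>" for w x z
  proof -
    have "z \<in> V" using ball that by blast
    then show "lamw w z \<le> K * lamw w a" "lamw w a \<le> K * lamw w z"
      using that near[OF that(2,3)] aV by (auto intro!: K simp: dist_commute)
  qed
  have close: "dist (word_map f w x) (word_map f w y) \<le> K * lamw w a * dist x y"
    if "set w \<subseteq> I" "x \<in> X" "y \<in> ball x \<delta>" for w x y
    using that ball lam_up by (intro word_map_lipschitz_ball[of w x \<delta>]) auto
  have "X \<subseteq> (\<Union>z\<in>X. ball z \<delta>)" using \<open>0 < \<delta>\<close> by force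
  then obtain Z where Z: "Z \<subseteq> X" "finite Z" "X \<subseteq> (\<Union>z\<in>Z. ball z \<delta>)"
    by (rule compactE_image[OF \<open>compact X\<close>, rotated]) auto
  have "\<forall>z\<in>Z. \<exists>D. \<forall>w. set w \<subseteq> I \<longrightarrow> dist (word_map f w a) (word_map f w z) \<le> D * lamw w a"
    using orbit_dist_bounded aV Z \<open>X \<subseteq> V\<close> by blast
  then obtain D where D: "\<forall>z\<in>Z. \<forall>w. set w \<subseteq> I \<longrightarrow> dist (word_map f w a) (word_map f w z) \<le> D z * lamw w a"
    by (rule bchoice[THEN exE])
  define D0 where "D0 = Max (insert 0 (D ` Z)) + K * \<delta>"
  have far: "dist (word_map f w a) (word_map f w x) \<le> D0 * lamw w a" if w: "set w \<subseteq> I" and x: "x \<in> X" for w x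
  proof -
    obtain z where z: "z \<in> Z" "x \<in> ball z \<delta>" using Z x by blast
    have pos: "0 < lamw w a" using lamw_pos w aV by blast
    have "dist (word_map f w a) (word_map f w z) \<le> D z * lamw w a" using D z w by blast
    also have "\<dots> \<le> Max (insert 0 (D ` Z)) * lamw w a"
      using Z z pos by (intro mult_right_mono) auto
    finally have 1: "dist (word_map f w a) (word_map f w z) \<le> Max (insert 0 (D ` Z)) * lamw w a" .
    have "dist (word_map f w z) (word_map f w x) \<le> K * lamw w a * dist z x"
      using close[OF w] z Z by blast
    also have "\<dots> \<le> K * lamw w a * \<delta>"
      using z pos \<open>1 \<le> K\<close> by (intro mult_left_mono) auto
    finally show ?thesis
      using 1 dist_triangle[of "word_map f w a" "word_map f w x" "word_map f w z"]
      by (simp add: D0_def algebra_simps)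
  qed
  have "0 \<le> Max (insert 0 (D ` Z))" using Z by simp
  then have "0 \<le> D0" using \<open>1 \<le> K\<close> \<open>0 < \<delta>\<close> by (simp add: D0_def)
  \<comment> \<open>The maximum serves the upper bound for near and for distant pairs; the other
    summand serves the lower bound.\<close>
  define C where "C = max K (2 * D0 / \<delta>) + K * (1 + (R + 1) / \<delta>)"
  have C1: "K \<le> C" "2 * D0 / \<delta> \<le> C" and C2: "K * (1 + (R + 1) / \<delta>) \<le> C"
    using \<open>0 \<le> D0\<close> \<open>1 \<le> K\<close> \<open>0 < \<delta>\<close> \<open>0 \<le> R\<close> by (auto simp: C_def add_increasing2)
  have "1 \<le> C" using C1 \<open>1 \<le> K\<close> by linarith
  moreover have "dist (word_map f w x) (word_map f w y) \<le> C * (lamw w a * dist x y)"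
    if w: "set w \<subseteq> I" and x: "x \<in> X" and y: "y \<in> X" for w x y
  proof (cases "dist x y < \<delta>")
    case True
    then have "dist (word_map f w x) (word_map f w y) \<le> K * (lamw w a * dist x y)"
      using close[OF w x] by (simp add: mult_ac)
    also have "\<dots> \<le> C * (lamw w a * dist x y)"
      using C1 lamw_pos[OF w aV] by (intro mult_right_mono) auto
    finally show ?thesis .
  next
    case False
    have "dist (word_map f w x) (word_map f w y) \<le> 2 * D0 * lamw w a"
      using far[OF w x] far[OF w y] dist_triangle2[of "word_map f w x" "word_map f w y" "word_map f w a"]
      by (simp add: dist_commute)
    also have "\<dots> = 2 * D0 / \<delta> * (lamw w a * \<delta>)" using \<open>0 < \<delta>\<close> by simp
    also have "\<dots> \<le> C * (lamw w a * dist x y)"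
      using C1 False lamw_pos[OF w aV] \<open>1 \<le> C\<close> \<open>0 < \<delta>\<close> by (intro mult_mono) auto
    finally show ?thesis .
  qed
  moreover have "lamw w a * dist x y / C \<le> dist (word_map f w x) (word_map f w y)"
    if w: "set w \<subseteq> I" and x: "x \<in> X" and y: "y \<in> X" for w x y
  proof -
    have pos: "0 < lamw w a" using lamw_pos w aV by blast
    have expand: "lamw w a / K * min \<delta> (dist x y) \<le> dist (word_map f w x) (word_map f w y)"
    proof (rule expanding_map_dist[OF \<open>0 < \<delta>\<close> _ ball[OF x] inj_word_map[OF w]])
      show "0 < lamw w a / K" using pos \<open>1 \<le> K\<close> by simp
      show "y \<in> V" using y \<open>X \<subseteq> V\<close> by blast
      fix z assume z: "z \<in> ball x \<delta>"
      then have "z \<in> V" using ball[OF x] by blast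
      have "lamw w a / K \<le> lamw w z" using lam_lo[OF w x z] \<open>1 \<le> K\<close> by (simp add: field_simps)
      then show "\<exists>D. (word_map f w has_derivative D) (at z) \<and> (\<forall>v. lamw w a / K * norm v \<le> norm (D v))"
        using word_map_derivative[OF w \<open>z \<in> V\<close>] by (metis mult_right_mono norm_ge_zero)
    qed
    have "dist x y \<le> (1 + (R + 1) / \<delta>) * min \<delta> (dist x y)"
    proof (cases "dist x y \<le> \<delta>")
      case True
      then show ?thesis using \<open>0 \<le> R\<close> \<open>0 < \<delta>\<close> by (simp add: distrib_right)
    next
      case False
      have "(1 + (R + 1) / \<delta>) * \<delta> = \<delta> + (R + 1)" using \<open>0 < \<delta>\<close> by (simp add: field_simps)
      then show ?thesis using False R[OF x y] \<open>0 < \<delta>\<close> by simp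
    qed
    then have "lamw w a / K * dist x y \<le> lamw w a / K * ((1 + (R + 1) / \<delta>) * min \<delta> (dist x y))"
      using pos \<open>1 \<le> K\<close> by (intro mult_left_mono) auto
    also have "\<dots> = (1 + (R + 1) / \<delta>) * (lamw w a / K * min \<delta> (dist x y))" by simp
    also have "\<dots> \<le> (1 + (R + 1) / \<delta>) * dist (word_map f w x) (word_map f w y)"
      using expand \<open>0 \<le> R\<close> \<open>0 < \<delta>\<close> by (intro mult_left_mono) auto
    finally have "lamw w a * dist x y \<le> K * (1 + (R + 1) / \<delta>) * dist (word_map f w x) (word_map f w y)"
      using \<open>1 \<le> K\<close> by (simp add: field_simps)
    also have "\<dots> \<le> C * dist (word_map f w x) (word_map f w y)"
      using C2 by (rule mult_right_mono) auto
    finally show ?thesis using \<open>1 \<le> C\<close> by (simp add: field_simps)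
  qed
  ultimately show ?thesis using that by blast
qed

section \<open>Counting incomparable words by volume\<close>

lemma disjoint_word_images:
  assumes "U \<subseteq> V" and sub: "\<And>i. i \<in> I \<Longrightarrow> f i ` U \<subseteq> U" and disj: "disjoint_family_on (\<lambda>i. f i ` U) I"
  shows "set u \<subseteq> I \<Longrightarrow> set v \<subseteq> I \<Longrightarrow> (\<And>z. v \<noteq> u @ z) \<Longrightarrow> (\<And>z. u \<noteq> v @ z) \<Longrightarrow>
    word_map f u ` U \<inter> word_map f v ` U = {}"
proof (induction u arbitrary: v)
  case (Cons i u)
  have inU: "word_map f w ` U \<subseteq> U" if "set w \<subseteq> I" for w
    using that sub by (induction w) (auto simp: image_subset_iff)
  obtain j v' where v: "v = j # v'" using Cons.prems(4)[of "i # u"] by (cases v) auto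
  have iI: "i \<in> I" "j \<in> I" "set u \<subseteq> I" "set v' \<subseteq> I" using Cons.prems v by auto
  show ?case
  proof (cases "i = j")
    case False
    then have "f i ` U \<inter> f j ` U = {}" using disj iI by (auto simp: disjoint_family_on_def)
    then show ?thesis
      using inU[OF iI(3)] inU[OF iI(4)] unfolding v word_map.simps image_comp[symmetric] by blast
  next
    \<comment> \<open>A common first letter is stripped by injectivity of \<open>f i\<close>;
      incomparable words must eventually differ in a letter.\<close>
    case True
    have "word_map f u ` U \<inter> word_map f v' ` U = {}"
      using Cons.prems v True by (intro Cons.IH) auto
    moreover have "word_map f u ` U \<subseteq> V" "word_map f v' ` U \<subseteq> V"
      using inU iI \<open>U \<subseteq> V\<close> by blast+
    ultimately have "f i ` word_map f u ` U \<inter> f i ` word_map f v' ` U = {}"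
      using inj_on_image_Int[OF inj[OF iI(1)], of "word_map f u ` U" "word_map f v' ` U"] by simp
    then show ?thesis using True v by (simp add: image_comp)
  qed
next
  case Nil
  then show ?case using Nil.prems(3)[of v] by simp
qed

text \<open>Incomparable words have disjoint images of \<open>U\<close>, each containing a ball of
  radius comparable to \<open>\<rho>\<close>. All these balls lie in one ball of comparable radius,
  and comparing volumes bounds their number.\<close>

lemma word_count:
  assumes "open U" "U \<noteq> {}" "U \<subseteq> V" and sub: "\<And>i. i \<in> I \<Longrightarrow> f i ` U \<subseteq> U"
    and disj: "disjoint_family_on (\<lambda>i. f i ` U) I"
    and "compact E" "E \<subseteq> V" "a \<in> E"
  shows "\<exists>M::nat. \<forall>\<rho> z S. 0 < \<rho> \<longrightarrow> finite S \<longrightarrow>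
      (\<forall>w\<in>S. set w \<subseteq> I \<and> \<rho> \<le> R * lamw w a \<and> lamw w a \<le> \<rho> \<and>
        word_map f w ` E \<inter> cball z (R * \<rho>) \<noteq> {}) \<longrightarrow>
      (\<forall>u\<in>S. \<forall>v. u @ v \<in> S \<longrightarrow> v = []) \<longrightarrow> card S \<le> M"
proof (cases "0 < R")
  case False
  have "S = {}" if "0 < \<rho>" "\<forall>w\<in>S. set w \<subseteq> I \<and> \<rho> \<le> R * lamw w a" for \<rho> and S :: "'i list set"
  proof (rule ccontr)
    assume "S \<noteq> {}"
    then obtain w where "set w \<subseteq> I" "\<rho> \<le> R * lamw w a" using \<open>\<forall>w\<in>S. _\<close> by blast
    moreover from this have "0 < lamw w a" using lamw_pos assms by blast
    ultimately show False using False \<open>0 < \<rho>\<close> mult_nonpos_nonneg[of R "lamw w a"] by simp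
  qed
  then show ?thesis by (intro exI[of _ 0]) (auto simp: card_eq_0_iff)
next
  case True
  obtain b where b: "b \<in> U" using \<open>U \<noteq> {}\<close> by blast
  then obtain \<delta> where \<delta>: "0 < \<delta>" "ball b \<delta> \<subseteq> U" using \<open>open U\<close> open_contains_ball by blast
  have aV: "a \<in> V" using assms by blast
  obtain K where "1 \<le> K" and
    K: "\<And>w z z'. set w \<subseteq> I \<Longrightarrow> z \<in> V \<Longrightarrow> z' \<in> V \<Longrightarrow> dist z z' \<le> dist a b + \<delta> \<Longrightarrow> lamw w z \<le> K * lamw w z'"
    using lamw_distortion by blast
  \<comment> \<open>The centre \<open>b\<close> of the ball in \<open>U\<close> may lie outside
    \<open>E\<close>, yet its images must be located relative to those of \<open>E\<close>.\<close>
  let ?X = "insert b E"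
  have X: "compact ?X" "?X \<subseteq> V" "a \<in> ?X" using assms b by auto
  obtain C where "1 \<le> C" and C: "\<And>w x y. set w \<subseteq> I \<Longrightarrow> x \<in> ?X \<Longrightarrow> y \<in> ?X \<Longrightarrow>
      lamw w a * dist x y / C \<le> dist (word_map f w x) (word_map f w y) \<and>
      dist (word_map f w x) (word_map f w y) \<le> C * (lamw w a * dist x y)"
    using word_map_bilipschitz[OF X] by blast
  define d where "d = diameter ?X"
  have d: "dist x b \<le> d" if "x \<in> E" for x
    unfolding d_def using compact_imp_bounded[OF X(1)] that by (intro diameter_bounded_bound) auto
  have "0 \<le> d" unfolding d_def using compact_imp_bounded[OF X(1)] by (rule diameter_ge_0)
  \<comment> \<open>Distortion turns the radius \<open>\<delta>\<close> into at least
    \<open>lamw w a / K * \<delta>\<close>, and \<open>lamw w a\<close> is at least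
    \<open>\<rho> / R\<close>.\<close>
  define \<kappa> where "\<kappa> = \<delta> / (R * K)"
  have "0 < \<kappa>" using \<delta> True \<open>1 \<le> K\<close> by (simp add: \<kappa>_def)
  \<comment> \<open>In units of \<open>\<rho>\<close>: from \<open>z\<close> to a point of the
    cylinder, from there to the image of \<open>b\<close>, and the radius of the small ball.\<close>
  define R' where "R' = R + C * d + \<kappa>"
  have "0 < R'" using True \<open>1 \<le> C\<close> \<open>0 \<le> d\<close> \<open>0 < \<kappa>\<close> by (simp add: R'_def add_nonneg_pos)
  have "card S \<le> nat \<lceil>(R' / \<kappa>) ^ DIM('a)\<rceil>"
    if "0 < \<rho>" and "finite S" and
      S: "\<forall>w\<in>S. set w \<subseteq> I \<and> \<rho> \<le> R * lamw w a \<and> lamw w a \<le> \<rho> \<and> word_map f w ` E \<inter> cball z (R * \<rho>) \<noteq> {}"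
      and anti: "\<forall>u\<in>S. \<forall>v. u @ v \<in> S \<longrightarrow> v = []" for \<rho> z S
  proof -
    have image: "ball (word_map f w b) (\<kappa> * \<rho>) \<subseteq> word_map f w ` U" if "w \<in> S" for w
    proof -
      have w: "set w \<subseteq> I" "\<rho> \<le> R * lamw w a" using S that by auto
      have pos: "0 < lamw w a" using lamw_pos w aV by blast
      have ballV: "ball b \<delta> \<subseteq> V" using \<delta> \<open>U \<subseteq> V\<close> by blast
      have "ball (word_map f w b) (lamw w a / K * \<delta>) \<subseteq> word_map f w ` ball b \<delta>"
      proof (rule expanding_map_ball[OF \<delta>(1)])
        show "0 < lamw w a / K" using pos \<open>1 \<le> K\<close> by simp
        show "inj_on (word_map f w) (ball b \<delta>)" using inj_word_map[OF w(1)] ballV by (rule inj_on_subset)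
        fix z assume z: "z \<in> ball b \<delta>"
        then have zV: "z \<in> V" using ballV by blast
        have "lamw w a \<le> K * lamw w z"
          using z dist_triangle[of a z b] by (intro K[OF w(1) aV zV]) auto
        then have "lamw w a / K \<le> lamw w z" using \<open>1 \<le> K\<close> by (simp add: field_simps)
        then show "\<exists>D. (word_map f w has_derivative D) (at z) \<and> (\<forall>v. lamw w a / K * norm v \<le> norm (D v))"
          using word_map_derivative[OF w(1) zV] by (metis mult_right_mono norm_ge_zero)
      qed
      moreover have "\<kappa> * \<rho> \<le> lamw w a / K * \<delta>"
      proof -
        have "\<kappa> * \<rho> \<le> \<kappa> * (R * lamw w a)" using w \<open>0 < \<kappa>\<close> by (intro mult_left_mono) auto
        also have "\<dots> = lamw w a / K * \<delta>" using True \<open>1 \<le> K\<close> by (simp add: \<kappa>_def)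
        finally show ?thesis .
      qed
      ultimately show ?thesis using \<delta>(2) subset_ball[of "\<kappa> * \<rho>" "lamw w a / K * \<delta>" "word_map f w b"] by blast
    qed
    have "disjoint_family_on (\<lambda>w. ball (word_map f w b) (\<kappa> * \<rho>)) S"
      unfolding disjoint_family_on_def
    proof (intro ballI impI)
      fix u v assume uv: "u \<in> S" "v \<in> S" "u \<noteq> v"
      have "word_map f u ` U \<inter> word_map f v ` U = {}"
      proof (rule disjoint_word_images[OF \<open>U \<subseteq> V\<close> sub disj])
        show "set u \<subseteq> I" "set v \<subseteq> I" using S uv by auto
        show "v \<noteq> u @ z" "u \<noteq> v @ z" for z using anti uv by (metis append_Nil2)+
      qed
      then show "ball (word_map f u b) (\<kappa> * \<rho>) \<inter> ball (word_map f v b) (\<kappa> * \<rho>) = {}"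
        using image[OF uv(1)] image[OF uv(2)] by auto
    qed
    moreover have "ball (word_map f w b) (\<kappa> * \<rho>) \<subseteq> ball z (R' * \<rho>)" if "w \<in> S" for w
    proof -
      have w: "set w \<subseteq> I" "lamw w a \<le> \<rho>" using S that by auto
      have pos: "0 < lamw w a" using lamw_pos w aV by blast
      obtain x where x: "x \<in> E" "dist z (word_map f w x) \<le> R * \<rho>" using S \<open>w \<in> S\<close> by force
      have "dist (word_map f w x) (word_map f w b) \<le> C * (lamw w a * dist x b)" using C[OF w(1)] x by blast
      also have "\<dots> \<le> C * (\<rho> * d)"
        using w pos d[OF x(1)] \<open>1 \<le> C\<close> \<open>0 < \<rho>\<close> by (intro mult_left_mono mult_mono) auto
      finally have "dist z (word_map f w b) \<le> R * \<rho> + C * (\<rho> * d)"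
        using x dist_triangle[of z "word_map f w b" "word_map f w x"] by linarith
      then have "dist z (word_map f w b) + \<kappa> * \<rho> \<le> R' * \<rho>" by (simp add: R'_def algebra_simps)
      then show ?thesis by (auto simp: subset_iff intro: le_less_trans[OF dist_triangle[of _ _ "word_map f w b"]])
    qed
    ultimately have "real (card S) \<le> (R' * \<rho> / (\<kappa> * \<rho>)) ^ DIM('a)"
      using \<open>finite S\<close> \<open>0 < \<kappa>\<close> \<open>0 < \<rho>\<close> \<open>0 < R'\<close> by (intro card_disjoint_balls) auto
    then show ?thesis using \<open>0 < \<rho>\<close> by (simp add: le_nat_iff le_ceiling_iff)
  qed
  then show ?thesis by blast
qed

text \<open>The derivative at one base point serves as the ratio. In \<open>lamw_append\<close> the
  first factor is evaluated at \<open>word_map f v a\<close> in place of \<open>a\<close>; both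
  points lie in \<open>E\<close>, so bounded distortion gives quasi-multiplicativity.\<close>

theorem quasi_self_similar_invariant_set:
  assumes "open U" "U \<noteq> {}" "U \<subseteq> V" and "\<And>i. i \<in> I \<Longrightarrow> f i ` U \<subseteq> U"
    and "disjoint_family_on (\<lambda>i. f i ` U) I"
    and "compact E" "E \<subseteq> V" "a \<in> E" and invariant: "E = (\<Union>i\<in>I. f i ` E)"
  shows "\<exists>K C. quasi_self_similar I f E (\<lambda>w. lamw w a) K C q"
proof -
  have aV: "a \<in> V" using assms by blast
  have inE: "word_map f w x \<in> E" if "set w \<subseteq> I" "x \<in> E" for w x
    using that by (induction w) (use invariant in auto)
  obtain K where "1 \<le> K" and
    K: "\<And>w z z'. set w \<subseteq> I \<Longrightarrow> z \<in> V \<Longrightarrow> z' \<in> V \<Longrightarrow> dist z z' \<le> diameter E \<Longrightarrow> lamw w z \<le> K * lamw w z'"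
    using lamw_distortion by blast
  obtain C where "1 \<le> C" and C: "\<And>w x y. set w \<subseteq> I \<Longrightarrow> x \<in> E \<Longrightarrow> y \<in> E \<Longrightarrow>
      lamw w a * dist x y / C \<le> dist (word_map f w x) (word_map f w y) \<and>
      dist (word_map f w x) (word_map f w y) \<le> C * (lamw w a * dist x y)"
    using word_map_bilipschitz[OF \<open>compact E\<close> \<open>E \<subseteq> V\<close> \<open>a \<in> E\<close>] by blast
  have "quasi_self_similar I f E (\<lambda>w. lamw w a) K C q"
  proof
    fix w v assume wv: "set (w @ v) \<subseteq> I"
    have va: "word_map f v a \<in> E" using inE wv \<open>a \<in> E\<close> by auto
    then have "dist (word_map f v a) a \<le> diameter E" "dist a (word_map f v a) \<le> diameter E"
      using compact_imp_bounded[OF \<open>compact E\<close>] \<open>a \<in> E\<close> by (auto intro: diameter_bounded_bound)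
    then have "lamw w (word_map f v a) \<le> K * lamw w a" "lamw w a \<le> K * lamw w (word_map f v a)"
      using wv va aV \<open>E \<subseteq> V\<close> by (auto intro!: K)
    moreover have "0 < lamw v a" using lamw_pos wv aV by auto
    ultimately show "lamw w a * lamw v a / K \<le> lamw (w @ v) a \<and> lamw (w @ v) a \<le> K * (lamw w a * lamw v a)"
      using \<open>1 \<le> K\<close> mult_right_mono[of _ _ "lamw v a"] by (auto simp: lamw_append field_simps)
  next
    show "lamw w a \<le> q ^ length w" "0 < lamw w a" if "set w \<subseteq> I" for w
      using that aV lamw_le lamw_pos by auto
    show "0 < q" using q_pos aV by blast
    show "\<exists>M::nat. \<forall>\<rho> z S. 0 < \<rho> \<longrightarrow> finite S \<longrightarrow>
      (\<forall>w\<in>S. set w \<subseteq> I \<and> \<rho> \<le> R * lamw w a \<and> lamw w a \<le> \<rho> \<and>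
        word_map f w ` E \<inter> cball z (R * \<rho>) \<noteq> {}) \<longrightarrow>
      (\<forall>u\<in>S. \<forall>v. u @ v \<in> S \<longrightarrow> v = []) \<longrightarrow> card S \<le> M" for R
      by (rule word_count[OF assms(1-8)])
  qed (use finite_I assms(6,8) invariant \<open>1 \<le> K\<close> \<open>1 \<le> C\<close> q_less_1 C in auto)
  then show ?thesis by blast
qed

end

section \<open>From the definitions to the abstract setting\<close>

lemma conformal_ifs_quasi_self_similar:
  fixes V :: "(real^'n) set"
  assumes ifs: "conformal_ifs V N f" and E: "ifs_invariant_set V N f E" and osc: "open_set_condition V N f"
  shows "\<exists>r K C q. quasi_self_similar {1..N} f E r K C q"
proof -
  define lam where "lam i x = onorm (frechet_derivative (f i) (at x))" for i x
  obtain \<gamma> where "0 < \<gamma>" and C1: "\<And>i. i \<in> {1..N} \<Longrightarrow> C1_holder_on \<gamma> V (f i)"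
    using ifs unfolding conformal_ifs_def by blast
  obtain L0 where "L0 < 1" and L0: "\<And>i. i \<in> {1..N} \<Longrightarrow> L0-lipschitz_on V (f i)"
    using ifs unfolding conformal_ifs_def by blast
  obtain c q where "0 < c" "q < 1" and cq: "\<And>i x. i \<in> {1..N} \<Longrightarrow> x \<in> V \<Longrightarrow> c \<le> lam i x \<and> lam i x \<le> q"
    using ifs unfolding conformal_ifs_def lam_def by blast
  have norm_deriv: "(f i has_derivative frechet_derivative (f i) (at x)) (at x)"
      "norm (frechet_derivative (f i) (at x) v) = lam i x * norm v"
    if i: "i \<in> {1..N}" and x: "x \<in> V" for i x v
  proof -
    have "conformal_on V (f i)" using ifs i unfolding conformal_ifs_def by blast
    then obtain k T where T: "orthogonal_transformation T" "(f i has_derivative (\<lambda>v. k *\<^sub>R T v)) (at x)"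
      using x unfolding conformal_on_def by blast
    have D: "frechet_derivative (f i) (at x) = (\<lambda>v. k *\<^sub>R T v)"
      using frechet_derivative_at[OF T(2)] by simp
    then show "(f i has_derivative frechet_derivative (f i) (at x)) (at x)" using T(2) by simp
    have nT: "norm (k *\<^sub>R T v) = \<bar>k\<bar> * norm v" for v
      using T(1) by (simp add: orthogonal_transformation)
    have "lam i x = \<bar>k\<bar>"
    proof (rule antisym)
      show "lam i x \<le> \<bar>k\<bar>" unfolding lam_def D by (rule onorm_bound) (auto simp: nT simp del: norm_scaleR)
      obtain j :: 'n where True by simp
      have "norm (k *\<^sub>R T (axis j 1)) \<le> onorm (\<lambda>v. k *\<^sub>R T v) * norm (axis j 1 :: real^'n)"
        using T(2) by (intro onorm has_derivative_bounded_linear)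
      then show "\<bar>k\<bar> \<le> lam i x" unfolding lam_def D nT by simp
    qed
    then show "norm (frechet_derivative (f i) (at x) v) = lam i x * norm v" by (simp only: D nT)
  qed
  \<comment> \<open>By conformality every column of the Jacobian has norm \<open>lam i x\<close>, so
    Hoelder bounds for the entries of a single column carry over to \<open>lam\<close>.\<close>
  obtain j :: 'n where True by simp
  have "\<exists>C. \<forall>x\<in>V. \<forall>y\<in>V. \<bar>partial_deriv (f i) j k x - partial_deriv (f i) j k y\<bar> \<le> C * dist x y powr \<gamma>"
    if "i \<in> {1..N}" for i k
    using C1[OF that] unfolding C1_holder_on_def holder_on_def by blast
  then have "\<forall>i k. \<exists>C. i \<in> {1..N} \<longrightarrow>
      (\<forall>x\<in>V. \<forall>y\<in>V. \<bar>partial_deriv (f i) j k x - partial_deriv (f i) j k y\<bar> \<le> C * dist x y powr \<gamma>)"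
    by blast
  then have "\<exists>C. \<forall>i k. i \<in> {1..N} \<longrightarrow>
      (\<forall>x\<in>V. \<forall>y\<in>V. \<bar>partial_deriv (f i) j k x - partial_deriv (f i) j k y\<bar> \<le> C i k * dist x y powr \<gamma>)"
    by (simp only: choice_iff)
  then obtain C where C: "\<forall>i k. i \<in> {1..N} \<longrightarrow>
      (\<forall>x\<in>V. \<forall>y\<in>V. \<bar>partial_deriv (f i) j k x - partial_deriv (f i) j k y\<bar> \<le> C i k * dist x y powr \<gamma>)"
    by (elim exE)
  define H where "H = (\<Sum>i\<in>{1..N}. \<Sum>k\<in>UNIV. \<bar>C i k\<bar>)"
  have holder: "\<bar>lam i x - lam i y\<bar> \<le> H * dist x y powr \<gamma>" if i: "i \<in> {1..N}" and x: "x \<in> V" and y: "y \<in> V" for i x y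
  proof -
    let ?e = "axis j 1 :: real^'n"
    let ?D = "\<lambda>z. frechet_derivative (f i) (at z) ?e"
    have "lam i x = norm (?D x)" "lam i y = norm (?D y)"
      using norm_deriv(2)[OF i x, of ?e] norm_deriv(2)[OF i y, of ?e] by simp_all
    then have "\<bar>lam i x - lam i y\<bar> \<le> norm (?D x - ?D y)" by (simp add: norm_triangle_ineq3)
    also have "\<dots> \<le> (\<Sum>k\<in>UNIV. \<bar>(?D x - ?D y) $ k\<bar>)" by (rule norm_le_l1_cart)
    also have "\<dots> \<le> (\<Sum>k\<in>UNIV. \<bar>C i k\<bar> * dist x y powr \<gamma>)"
    proof (rule sum_mono)
      fix k
      have "\<bar>(?D x - ?D y) $ k\<bar> \<le> C i k * dist x y powr \<gamma>"
        using C i x y by (simp add: partial_deriv_def)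
      also have "\<dots> \<le> \<bar>C i k\<bar> * dist x y powr \<gamma>" by (intro mult_right_mono) auto
      finally show "\<bar>(?D x - ?D y) $ k\<bar> \<le> \<bar>C i k\<bar> * dist x y powr \<gamma>" .
    qed
    also have "\<dots> = (\<Sum>k\<in>UNIV. \<bar>C i k\<bar>) * dist x y powr \<gamma>" by (simp add: sum_distrib_right)
    also have "\<dots> \<le> H * dist x y powr \<gamma>"
      unfolding H_def using i
      by (intro mult_right_mono member_le_sum) (auto intro: sum_nonneg)
    finally show ?thesis .
  qed
  \<comment> \<open>The predicate \<open>lipschitz_on\<close> admits the constant 0, while the
    distortion estimate uses powers of a positive \<open>L\<close>; the maximum with
    \<open>1 / 2\<close> is positive and still below 1.\<close>
  interpret conformal_system "{1..N}" V f lam \<gamma> H "max L0 (1 / 2)" c q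
  proof
    show "open V" "connected V" "{1..N} \<noteq> {}" using ifs by (auto simp: conformal_ifs_def)
    show "f i x \<in> V" if "i \<in> {1..N}" "x \<in> V" for i x
      using ifs that unfolding conformal_ifs_def by blast
    show "inj_on (f i) V" if "i \<in> {1..N}" for i using ifs that unfolding conformal_ifs_def by blast
    show "\<exists>D. (f i has_derivative D) (at x) \<and> (\<forall>v. norm (D v) = lam i x * norm v)"
      if "i \<in> {1..N}" "x \<in> V" for i x using norm_deriv[OF that] by blast
    show "dist (f i x) (f i y) \<le> max L0 (1 / 2) * dist x y" if "i \<in> {1..N}" "x \<in> V" "y \<in> V" for i x y
    proof -
      have "dist (f i x) (f i y) \<le> L0 * dist x y" using L0 that by (auto dest: lipschitz_onD)
      also have "\<dots> \<le> max L0 (1 / 2) * dist x y" by (intro mult_right_mono) auto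
      finally show ?thesis .
    qed
    show "0 \<le> H" by (simp add: H_def sum_nonneg)
  qed (use \<open>0 < \<gamma>\<close> \<open>L0 < 1\<close> \<open>0 < c\<close> \<open>q < 1\<close> cq holder in auto)
  obtain U where U: "open U" "U \<noteq> {}" "closure U \<subseteq> V" "\<And>i. i \<in> {1..N} \<Longrightarrow> f i ` U \<subseteq> U"
      "disjoint_family_on (\<lambda>i. f i ` U) {1..N}"
    using osc unfolding open_set_condition_def by blast
  have "U \<subseteq> V" using U(3) closure_subset by blast
  obtain a where a: "a \<in> E" using E unfolding ifs_invariant_set_def by blast
  have E': "compact E" "E \<subseteq> V" "E = (\<Union>i\<in>{1..N}. f i ` E)" using E unfolding ifs_invariant_set_def by blast+
  show ?thesis
    using quasi_self_similar_invariant_set[OF U(1,2) \<open>U \<subseteq> V\<close> U(4,5) E'(1,2) a E'(3)] by blast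
qed

theorem theorem3p3:
  fixes V :: "(real^'n) set" and f :: "nat \<Rightarrow> real^'n \<Rightarrow> real^'n" and N :: nat
    and W :: "(real^'p) set" and g :: "nat \<Rightarrow> real^'p \<Rightarrow> real^'p" and P :: nat
    and E E' :: "(real^'n) set" and F :: "(real^'p) set"
    and s :: real and h :: "real^'n \<Rightarrow> real^'p"
  assumes "conformal_ifs V N f" and "ifs_invariant_set V N f E"
    and "conformal_ifs W P g" and "ifs_invariant_set W P g F"
    and "open_set_condition V N f" and "open_set_condition W P g"
    and "hausdorff_dim E = ereal s" and "hausdorff_dim F = ereal s"
    and "E' \<subseteq> E" and "E' \<in> lambda_system UNIV UNIV (hausdorff_measure s)"
    and "hausdorff_measure s E' > 0"
    and "bilipschitz_map h E' F"
  shows "\<exists>h'. bilipschitz_map h' E F"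
proof -
  obtain r K C q where E: "quasi_self_similar {1..N} f E r K C q"
    using conformal_ifs_quasi_self_similar[OF assms(1,2,5)] by blast
  obtain r' K' C' q' where F: "quasi_self_similar {1..P} g F r' K' C' q'"
    using conformal_ifs_quasi_self_similar[OF assms(3,4,6)] by blast
  show ?thesis
    by (rule quasi_self_similar_embedding[OF E F assms(7,9,11,12)])
qed

end
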